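(* Let $C$ be the non-complete intersection Gorenstein monomial curve $x_i=t^{n_i}$ ($1\le i\le4$) in $\mathbb{A}^4(K)$, with $n_1<n_2<n_3<n_4$. Suppose that $I(C)$ is given as in case 1(b), i.e. $I(C)$ is minimally generated by $$f_1=x_1^{a_1}-x_3^{a_{13}}x_4^{a_{14}},\quad f_2=x_2^{a_2}-x_1^{a_{21}}x_3^{a_{23}},\quad f_3=x_3^{a_3}-x_2^{a_{32}}x_4^{a_{34}},$$ $$f_4=x_4^{a_4}-x_1^{a_{41}}x_2^{a_{42}},\quad f_5=x_1^{a_{21}}x_4^{a_{34}}-x_2^{a_{42}}x_3^{a_{13}}.$$ Then $C$ has Cohen-Macaulay tangent cone at the origin if and only if (1) $a_2\le a_{21}+a_{23}$, (2) $a_{42}+a_{13}\le a_{21}+a_{34}$, and (3) for every monomial $M=x_2^{u_2}x_3^{u_3}x_4^{u_4}$, where $u_2<a_{42}$, $u_3\ge a_3$ and $u_4<a_{14}$, with $u_2n_2+u_3n_3+u_4n_4\in n_1+\mathcal{S}$, there exists a monomial $N$ with $1\in\mathrm{supp}(N)$ such that $M-N\in I(C)$ and $\deg(M)\le\deg(N)$.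
   Context: $K$ is a field and $n_1,\dots,n_4$ are positive integers with $\gcd(n_1,\dots,n_4)=1$. $\mathbb{N}$ denotes the non-negative integers (exponents $u_i$ are in $\mathbb{N}$), $\mathcal{S}=\{g_1n_1+\cdots+g_4n_4: g_i\in\mathbb{N}\}$ and $n_1+\mathcal{S}=\{n_1+m:m\in\mathcal{S}\}$. $I(C)$ is the kernel of the $K$-algebra homomorphism $K[x_1,\dots,x_4]\to K[t]$, $x_i\mapsto t^{n_i}$. $C$ is Gorenstein if $\mathcal{S}$ is symmetric. For a monomial, $\deg(x_1^{u_1}\cdots x_4^{u_4})=u_1+\cdots+u_4$, and $\mathrm{supp}$ is the set of indices $i$ such that $x_i$ divides it. In the description of $I(C)$, all exponents are integers with $0<a_{ij}<a_j$, and (by Bresinsky) $a_1=a_{21}+a_{41}$, $a_2=a_{32}+a_{42}$, $a_3=a_{13}+a_{23}$, $a_4=a_{14}+a_{34}$. $C$ has Cohen-Macaulay tangent cone at the origin if the ring $K[x_1,\dots,x_4]/I(C)_*$ is Cohen-Macaulay, where $I(C)_*$ is generated by the homogeneous (standard grading) summands $f_*$ of least degree of the polynomials $f\in I(C)$. *)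

theory Defs
  imports
    "HOL-Algebra.Ring_Divisibility"
    "HOL-Algebra.QuotRing"
    "HOL-Algebra.Algebraic_Closure_Type"
    "HOL-Library.Poly_Mapping"
    "HOL-Library.Numeral_Type"
    "HOL-Library.Extended_Nat"
    "HOL-Computational_Algebra.Polynomial"
begin

section \<open>Cohen--Macaulay rings\<close>

text \<open>In a regular sequence each entry is a non-zero-divisor modulo the ideal generated by its
  predecessors, and the whole sequence generates a proper ideal.\<close>

definition regular_sequence :: "('a, 'b) ring_scheme \<Rightarrow> 'a list \<Rightarrow> bool" where
  "regular_sequence R xs \<longleftrightarrow>
     set xs \<subseteq> carrier R \<and>
     (\<forall>i<length xs. \<forall>y\<in>carrier R.
        (xs ! i) \<otimes>\<^bsub>R\<^esub> y \<in> genideal R (set (take i xs)) \<longrightarrow> y \<in> genideal R (set (take i xs))) \<and>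
     genideal R (set xs) \<noteq> carrier R"

definition ideal_depth :: "('a, 'b) ring_scheme \<Rightarrow> 'a set \<Rightarrow> enat" where
  "ideal_depth R J = (SUP xs \<in> {xs. regular_sequence R xs \<and> set xs \<subseteq> J}. enat (length xs))"

text \<open>The height (codimension) of a prime ideal: the supremum of the lengths of strict chains of
  prime ideals ending in it.\<close>

definition prime_height :: "('a, 'b) ring_scheme \<Rightarrow> 'a set \<Rightarrow> enat" where
  "prime_height R Q =
     (SUP k \<in> {k. \<exists>C :: nat \<Rightarrow> 'a set.
                   (\<forall>i\<le>k. primeideal (C i) R) \<and> (\<forall>i<k. C i \<subset> C (Suc i)) \<and> C k = Q}. enat k)"

text \<open>Definition of a Cohen--Macaulay ring as in Eisenbud, \<^emph>\<open>Commutative Algebra with a View Toward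
  Algebraic Geometry\<close>, Section 18.2: a Noetherian commutative ring in which every maximal ideal
  has depth equal to its codimension.\<close>

definition cohen_macaulay :: "('a, 'b) ring_scheme \<Rightarrow> bool" where
  "cohen_macaulay R \<longleftrightarrow>
     cring R \<and> noetherian_ring R \<and>
     (\<forall>Q. maximalideal Q R \<longrightarrow> ideal_depth R Q = prime_height R Q)"


section \<open>Polynomials in four variables\<close>

text \<open>The variables are indexed by the four-element type \<open>4\<close>, whose elements are \<open>1, 2, 3, 4\<close>
  (with \<open>4 = 0\<close>). Exponent vectors are of type \<open>4 \<Rightarrow>\<^sub>0 nat\<close>, and the type \<open>'k poly4\<close>, with the
  convolution product of \<^theory>\<open>HOL-Library.Poly_Mapping\<close>, is the polynomial ring
  in four variables over \<open>'k\<close>.\<close>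

type_synonym 'k poly4 = "(4 \<Rightarrow>\<^sub>0 nat) \<Rightarrow>\<^sub>0 'k"

abbreviation poly4_ring :: "'k::field poly4 ring" where
  "poly4_ring \<equiv> ring_of_type_algebra"

definition monom4 :: "(4 \<Rightarrow>\<^sub>0 nat) \<Rightarrow> 'k::field poly4" where
  "monom4 u = Poly_Mapping.single u 1"

definition Var :: "4 \<Rightarrow> 'k::field poly4" where
  "Var i = monom4 (Poly_Mapping.single i 1)"

text \<open>The degree of the monomial \<open>monom4 u\<close>; its support is \<open>Poly_Mapping.keys u\<close>.\<close>

definition mdeg :: "(4 \<Rightarrow>\<^sub>0 nat) \<Rightarrow> nat" where
  "mdeg u = (\<Sum>i\<in>UNIV. Poly_Mapping.lookup u i)"

text \<open>The homogeneous summand of least degree (and \<open>0\<close> for the zero polynomial).\<close>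

definition initial_form :: "'k::field poly4 \<Rightarrow> 'k poly4" where
  "initial_form f =
     (\<Sum>u | u \<in> Poly_Mapping.keys f \<and> (\<forall>v\<in>Poly_Mapping.keys f. mdeg u \<le> mdeg v).
        Poly_Mapping.single u (Poly_Mapping.lookup f u))"

definition initial_ideal :: "'k::field poly4 set \<Rightarrow> 'k poly4 set" where
  "initial_ideal I = genideal poly4_ring (initial_form ` I)"

definition minimally_generates :: "'k::field poly4 set \<Rightarrow> 'k poly4 set \<Rightarrow> bool" where
  "minimally_generates G I \<longleftrightarrow>
     genideal poly4_ring G = I \<and> (\<forall>H. H \<subset> G \<longrightarrow> genideal poly4_ring H \<noteq> I)"


section \<open>Monomial curves in affine 4-space\<close>

text \<open>The \<open>K\<close>-algebra homomorphism to the univariate polynomials sending \<open>Var i\<close> to \<open>t\<close> to the power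
  \<open>n i\<close>, and its kernel.\<close>

definition param_hom :: "(4 \<Rightarrow> nat) \<Rightarrow> 'k::field poly4 \<Rightarrow> 'k poly" where
  "param_hom n f =
     (\<Sum>u\<in>Poly_Mapping.keys f. Polynomial.smult (Poly_Mapping.lookup f u)
        (\<Prod>i\<in>UNIV. (Polynomial.monom 1 (n i)) ^ Poly_Mapping.lookup u i))"

definition curve_ideal :: "(4 \<Rightarrow> nat) \<Rightarrow> 'k::field poly4 set" where
  "curve_ideal n = {f. param_hom n f = 0}"

text \<open>A curve in affine 4-space has codimension 3.\<close>

definition curve_complete_intersection :: "'k::field poly4 set \<Rightarrow> bool" where
  "curve_complete_intersection I \<longleftrightarrow> (\<exists>G. card G = 3 \<and> genideal poly4_ring G = I)"

definition num_semigroup :: "(4 \<Rightarrow> nat) \<Rightarrow> nat set" where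
  "num_semigroup n = {\<Sum>i\<in>UNIV. g i * n i | g :: 4 \<Rightarrow> nat. True}"

text \<open>Here \<open>F\<close> is the Frobenius number, the largest integer outside the semigroup; it is \<open>- 1\<close> if the
  semigroup consists of all natural numbers.\<close>

definition symmetric_semigroup :: "nat set \<Rightarrow> bool" where
  "symmetric_semigroup S \<longleftrightarrow>
     (\<exists>F::int. F \<notin> int ` S \<and> (\<forall>z>F. z \<in> int ` S) \<and> (\<forall>z. z \<in> int ` S \<longleftrightarrow> F - z \<notin> int ` S))"

definition cm_tangent_cone :: "'k::field poly4 set \<Rightarrow> bool" where
  "cm_tangent_cone I \<longleftrightarrow> cohen_macaulay (poly4_ring Quot (initial_ideal I))"

end

theory Submission
  imports Defs
begin

text \<open>Let \<open>A\<close> be the coordinate ring of the tangent cone, the quotient of \<open>K[x1,x2,x3,x4]\<close> by the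
ideal of initial forms, and let \<open>S\<close> be the semigroup of weights. The theorem is reduced to a
statement about monomials, and that statement is settled by exchanging monomials along the five
binomials.

\<^bold>\<open>From Cohen--Macaulayness to a nonzerodivisor.\<close> Since \<open>n 1\<close> is the least weight, the binomials
\<open>x_i ^ n_1 - x_1 ^ n_i\<close> show that \<open>x2, x3, x4\<close> are nilpotent in \<open>A\<close>, while no power of \<open>x1\<close>
vanishes. So \<open>A\<close> is a finite algebra over \<open>K[x1]\<close> whose reduction is \<open>K[x1]\<close>. In such a ring every
maximal ideal has height \<open>1\<close> and depth at most \<open>1\<close> (\<open>prime_height_maximal\<close>,
\<open>regular_sequence_length_le_1\<close>), and Cohen--Macaulayness means that every maximal ideal contains a
nonzerodivisor. At the origin this forces \<open>x1\<close> to be a nonzerodivisor; conversely it is enough that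
\<open>A\<close> be torsion-free over \<open>K[x1]\<close>.

\<^bold>\<open>From a nonzerodivisor to degrees.\<close> Say that a monomial has top degree if no monomial of the same
weight has larger degree. The ideal of initial forms is the kernel of the linear map that
sends a monomial of top degree and weight \<open>w\<close> to \<open>t ^ w\<close> and all other monomials to \<open>0\<close>
(\<open>initial_ideal_curve_ideal\<close>). Hence \<open>x1\<close> is a nonzerodivisor on \<open>A\<close> exactly if multiplication
by \<open>x1\<close> preserves top degree. In that case the map is linear over \<open>K[x1]\<close>, with \<open>x1\<close> acting
as \<open>t ^ n_1\<close>, and \<open>A\<close> is torsion-free. In other words (\<open>cm_tangent_cone_iff\<close>): the tangent cone is
Cohen--Macaulay iff every monomial \<open>M\<close> with weight in \<open>n_1 + S\<close> has the weight of some \<open>N\<close> that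
is divisible by \<open>x1\<close> and has degree at least that of \<open>M\<close>.

\<^bold>\<open>Exchanging monomials.\<close> Two monomials of equal weight are connected by exchanges of one term of a
generator for the other (\<open>fibre_in_closed_class\<close>), so fibres of the weight map can be read
off the generators. The fibres of \<open>x2 ^ a2\<close> and of \<open>x2 ^ a42 * x3 ^ a13\<close> have just two elements,
so conditions (1) and (2) are necessary; (3) is a special case of the criterion. Conversely,
a monomial \<open>M\<close> in \<open>x2, x3, x4\<close> that is divisible by a term of \<open>f1\<close>, \<open>f2\<close>, \<open>f4\<close> or \<open>f5\<close> is
exchanged for a multiple of \<open>x1\<close>, and the degree does not drop: for \<open>f1\<close> and \<open>f4\<close> because \<open>n_1\<close>
is the least and \<open>n_4\<close> the greatest weight, for \<open>f2\<close> and \<open>f5\<close> by (1) and (2). Otherwise only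
\<open>f3\<close> applies to \<open>M\<close>. If the exponent of \<open>x3\<close> is at least \<open>a3\<close>, then (3) applies; if not, the
fibre of \<open>M\<close> is obtained by repeatedly replacing \<open>x2 ^ a32 * x4 ^ a34\<close> by \<open>x3 ^ a3\<close> and contains
no multiple of \<open>x1\<close> at all (\<open>stuck_fibre_avoids_x1\<close>).\<close>

section \<open>Divisibility of univariate polynomials\<close>

lemma poly_ideal_principal:
  fixes L :: "'k::field poly set"
  assumes ne: "L \<noteq> {}" and diff: "\<And>p q. p \<in> L \<Longrightarrow> q \<in> L \<Longrightarrow> p - q \<in> L"
    and mult: "\<And>p q. p \<in> L \<Longrightarrow> p * q \<in> L"
  shows "\<exists>g\<in>L. \<forall>p\<in>L. g dvd p"
proof (cases "L \<subseteq> {0}")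
  case True
  with ne show ?thesis by auto
next
  case False
  define g where "g = arg_min Polynomial.degree (\<lambda>p. p \<in> L \<and> p \<noteq> 0)"
  from False obtain p0 where "p0 \<in> L \<and> p0 \<noteq> 0" by auto
  then have g: "g \<in> L \<and> g \<noteq> 0" unfolding g_def by (rule arg_min_natI)
  have min: "Polynomial.degree g \<le> Polynomial.degree p" if "p \<in> L" "p \<noteq> 0" for p
    unfolding g_def using that by (intro arg_min_nat_le) auto
  have "g dvd p" if "p \<in> L" for p
  proof -
    have "p mod g = p - g * (p div g)" by (simp add: minus_mult_div_eq_mod)
    then have "p mod g \<in> L" using diff mult g that by metis
    then have "p mod g = 0"
      using min degree_mod_less[of g p] g by fastforce
    then show ?thesis by (simp add: dvd_eq_mod_eq_0)
  qed
  with g show ?thesis by blast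
qed

lemma poly_split_off_power:
  fixes a g :: "'k::field poly"
  assumes "a \<noteq> 0" "\<not> g dvd 1"
  shows "\<exists>m s. a = g ^ m * s \<and> \<not> g dvd s"
  using assms(1)
proof (induction "Polynomial.degree a" arbitrary: a rule: less_induct)
  case less
  show ?case
  proof (cases "g dvd a")
    case False
    then show ?thesis by (intro exI[of _ 0] exI[of _ a]) auto
  next
    case True
    then obtain b where b: "a = g * b" by blast
    with less.prems have nz: "g \<noteq> 0" "b \<noteq> 0" by auto
    then have "Polynomial.degree g > 0" using assms(2) is_unit_iff_degree by blast
    then have "Polynomial.degree b < Polynomial.degree a"
      using b nz by (simp add: degree_mult_eq)
    from less.hyps[OF this nz(2)] obtain m s where "b = g ^ m * s" "\<not> g dvd s" by blast
    with b show ?thesis by (intro exI[of _ "Suc m"] exI[of _ s]) (auto simp: mult.assoc)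
  qed
qed


section \<open>Cohen--Macaulayness of a nilpotent thickening of the affine line\<close>

definition nonzerodivisor :: "('a, 'b) ring_scheme \<Rightarrow> 'a \<Rightarrow> bool" where
  "nonzerodivisor R a \<longleftrightarrow> (\<forall>y\<in>carrier R. a \<otimes>\<^bsub>R\<^esub> y = \<zero>\<^bsub>R\<^esub> \<longrightarrow> y = \<zero>\<^bsub>R\<^esub>)"

context cring begin

text \<open>Used with a nilpotent \<open>d\<close>: an element that is nilpotent modulo \<open>J\<close> up to a nilpotent has a power in
\<open>J\<close>.\<close>

lemma power_congruent_mod_ideal:
  assumes J: "ideal J R" and c: "c \<in> carrier R" "d \<in> carrier R" "c \<ominus> d \<in> J"
  shows "c [^] (N::nat) \<ominus> d [^] N \<in> J"
proof -
  interpret J: ideal J R by fact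
  show ?thesis
  proof (induction N)
    case 0
    show ?case using J.zero_closed by (simp add: a_minus_def r_neg)
  next
    case (Suc N)
    have "c [^] Suc N \<ominus> d [^] Suc N = c [^] N \<otimes> (c \<ominus> d) \<oplus> (c [^] N \<ominus> d [^] N) \<otimes> d"
    proof -
      have "p \<otimes> c \<ominus> q \<otimes> d = p \<otimes> (c \<ominus> d) \<oplus> (p \<ominus> q) \<otimes> d"
        if "p \<in> carrier R" "q \<in> carrier R" for p q
        using that c(1,2) by algebra
      then show ?thesis using c by simp
    qed
    then show ?case using Suc J.I_l_closed J.I_r_closed c J.a_closed by simp
  qed
qed

lemma power_cancel_mod_ideal:
  assumes b: "b \<in> carrier R" and reg: "\<forall>y\<in>carrier R. b \<otimes> y \<in> J \<longrightarrow> y \<in> J"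
  shows "y \<in> carrier R \<Longrightarrow> b [^] (k::nat) \<otimes> y \<in> J \<Longrightarrow> y \<in> J"
proof (induction k arbitrary: y)
  case 0
  then show ?case by simp
next
  case (Suc k)
  have "b [^] Suc k \<otimes> y = b [^] k \<otimes> (b \<otimes> y)" using Suc.prems b by (simp add: m_assoc)
  then have "b \<otimes> y \<in> J" using Suc b by simp
  then show ?case using reg Suc.prems(1) by blast
qed

lemma genideal_empty: "Idl {} = {\<zero>}"
  using genideal_minimal[OF zeroideal, of "{}"]
    additive_subgroup.zero_closed[OF ideal.axioms(1)[OF genideal_ideal[of "{}"]]] by auto

lemma primeideal_power:
  assumes C: "primeideal C R" and c: "c \<in> carrier R" "c [^] (N::nat) \<in> C"
  shows "c \<in> C"
proof -
  interpret primeideal C R by fact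
  show ?thesis using c(2)
  proof (induction N)
    case 0
    then show ?case using one_imp_carrier I_notcarr by simp
  next
    case (Suc N)
    then show ?case using I_prime[of "c [^] N" c] c(1) by auto
  qed
qed

end

text \<open>The spectrum of \<open>R\<close> is an affine line: \<open>R\<close> maps onto \<open>K[X]\<close> with a kernel of nilpotent elements.\<close>

locale nilpotent_thickening = cring R for R (structure) +
  fixes h :: "'a \<Rightarrow> 'k::field poly"
  assumes h_add: "\<lbrakk>a \<in> carrier R; b \<in> carrier R\<rbrakk> \<Longrightarrow> h (a \<oplus> b) = h a + h b"
    and h_mult: "\<lbrakk>a \<in> carrier R; b \<in> carrier R\<rbrakk> \<Longrightarrow> h (a \<otimes> b) = h a * h b"
    and h_one: "h \<one> = 1"
    and h_surj: "\<exists>a\<in>carrier R. h a = p"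
    and h_nil: "\<lbrakk>a \<in> carrier R; h a = 0\<rbrakk> \<Longrightarrow> \<exists>N::nat. a [^] N = \<zero>"
begin

lemma h_zero [simp]: "h \<zero> = 0"
  using h_add[of \<zero> \<zero>] by (metis add_cancel_right_left l_zero zero_closed)

lemma h_diff: "\<lbrakk>a \<in> carrier R; b \<in> carrier R\<rbrakk> \<Longrightarrow> h (a \<ominus> b) = h a - h b"
proof -
  assume ab: "a \<in> carrier R" "b \<in> carrier R"
  then have "(a \<ominus> b) \<oplus> b = a" by algebra
  with h_add[of "a \<ominus> b" b] ab show ?thesis by (metis add_diff_cancel minus_closed)
qed

lemma h_pow: "a \<in> carrier R \<Longrightarrow> h (a [^] (k::nat)) = h a ^ k"
  by (induction k) (auto simp: h_one h_mult)

text \<open>Radicals of ideals can be tested after applying \<open>h\<close>: lifting the cofactor of \<open>h a\<close> in \<open>h c\<close> shows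
that \<open>c\<close> is congruent modulo \<open>a\<close> to an element of the kernel, which is nilpotent.\<close>

lemma power_mem_ideal:
  assumes J: "ideal J R" and a: "a \<in> J" and c: "c \<in> carrier R" "h a dvd h c"
  shows "\<exists>N::nat. c [^] N \<in> J"
proof -
  interpret J: ideal J R by fact
  obtain q where q: "h c = h a * q" using c(2) by blast
  obtain t where t: "t \<in> carrier R" "h t = q" using h_surj by blast
  have ac: "a \<in> carrier R" using a J.Icarr by blast
  define d where "d = c \<ominus> a \<otimes> t"
  have d: "d \<in> carrier R" using c ac t by (simp add: d_def)
  have "h d = 0" using c ac t q by (simp add: d_def h_diff h_mult)
  with h_nil d obtain N :: nat where N: "d [^] N = \<zero>" by blast
  have "c \<ominus> d = a \<otimes> t" unfolding d_def using c ac t by algebra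
  then have "c \<ominus> d \<in> J" using J.I_r_closed a t by simp
  from power_congruent_mod_ideal[OF J c(1) d this, of N]
  have "c [^] N \<in> J" using N c by (simp add: a_minus_def)
  then show ?thesis ..
qed

lemma ideal_image_principal:
  assumes J: "ideal J R"
  shows "\<exists>g\<in>J. \<forall>c\<in>J. h g dvd h c"
proof -
  interpret J: ideal J R by fact
  have "\<exists>g\<in>h ` J. \<forall>p\<in>h ` J. g dvd p"
  proof (rule poly_ideal_principal)
    show "h ` J \<noteq> {}" using J.zero_closed by blast
  next
    fix p q assume "p \<in> h ` J" "q \<in> h ` J"
    then obtain a b where "a \<in> J" "b \<in> J" "p = h a" "q = h b" by blast
    then show "p - q \<in> h ` J"
      using h_diff[of a b] J.Icarr[of a] J.Icarr[of b] J.a_closed[of a "\<ominus> b"] J.a_inv_closed[of b]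
      by (metis a_minus_def imageI)
  next
    fix p q assume "p \<in> h ` J"
    then obtain a where a: "a \<in> J" "p = h a" by blast
    obtain t where "t \<in> carrier R" "h t = q" using h_surj by blast
    then show "p * q \<in> h ` J"
      using a h_mult[of a t] J.Icarr[of a] J.I_r_closed[of a t] by (metis imageI)
  qed
  then show ?thesis by blast
qed

text \<open>A prime ideal contains all nilpotent elements, so it is the preimage of an ideal of \<open>K[X]\<close>, which is
principal.\<close>

lemma prime_membership:
  assumes C: "primeideal C R"
  obtains g where "g \<in> C" "\<And>c. c \<in> carrier R \<Longrightarrow> c \<in> C \<longleftrightarrow> h g dvd h c"
proof -
  interpret primeideal C R by fact
  obtain g where g: "g \<in> C" "\<forall>c\<in>C. h g dvd h c"
    using ideal_image_principal[OF is_ideal] by blast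
  have "c \<in> C \<longleftrightarrow> h g dvd h c" if "c \<in> carrier R" for c
    using g power_mem_ideal[OF is_ideal g(1) that] primeideal_power[OF C that] by blast
  with g(1) that show thesis by blast
qed

lemma preimage_ideal: "ideal {c \<in> carrier R. p dvd h c} R"
proof (rule idealI)
  show "ring R" by (rule ring_axioms)
  show "subgroup {c \<in> carrier R. p dvd h c} (add_monoid R)"
  proof (rule add.subgroupI)
    show "{c \<in> carrier R. p dvd h c} \<noteq> {}" using zero_closed by force
  next
    fix a assume "a \<in> {c \<in> carrier R. p dvd h c}"
    then show "\<ominus> a \<in> {c \<in> carrier R. p dvd h c}"
      using h_diff[of \<zero> a] by (auto simp: a_minus_def)
  qed (auto simp: h_add)
qed (auto simp: h_mult)

lemma kernel_prime: "primeideal {c \<in> carrier R. h c = 0} R"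
proof (rule primeidealI)
  show "ideal {c \<in> carrier R. h c = 0} R" using preimage_ideal[of 0] by simp
  show "cring R" by (rule is_cring)
  show "carrier R \<noteq> {c \<in> carrier R. h c = 0}" using h_one one_closed by (metis (mono_tags, lifting) mem_Collect_eq zero_neq_one)
qed (auto simp: h_mult)

text \<open>The kernel of \<open>h\<close> is not maximal because \<open>K[X]\<close> is not a field: it is properly contained in the
preimage of the ideal generated by \<open>X\<close>.\<close>

lemma maximal_image_nonzero:
  assumes Q: "maximalideal Q R"
  obtains c where "c \<in> Q" "h c \<noteq> 0"
proof (rule ccontr)
  interpret Q: maximalideal Q R by fact
  assume "\<not> thesis"
  with that have Q0: "\<And>c. c \<in> Q \<Longrightarrow> h c = 0" by blast
  let ?X = "[:0, 1:] :: 'k poly"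
  let ?K = "{c \<in> carrier R. ?X dvd h c}"
  have nd: "\<not> ?X dvd 1" by (simp add: is_unit_iff_degree)
  have "Q \<subseteq> ?K" using Q0 Q.Icarr by auto
  then have "?K = Q \<or> ?K = carrier R" using Q.I_maximal[OF preimage_ideal] by auto
  moreover have "\<one> \<notin> ?K" using nd h_one by simp
  then have "?K \<noteq> carrier R" using one_closed by blast
  moreover obtain x where "x \<in> carrier R" "h x = ?X" using h_surj by blast
  then have "x \<in> ?K" "x \<notin> Q" using Q0 by auto
  then have "?K \<noteq> Q" by blast
  ultimately show False by blast
qed

text \<open>A nonzero prime ideal of \<open>K[X]\<close> is maximal: if it is generated by \<open>h g1 = h g2 * q\<close>, then \<open>h g1\<close>
divides \<open>q\<close>, which makes \<open>h g2\<close> a unit, or it divides \<open>h g2\<close>, which makes the two ideals equal.\<close>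

lemma no_prime_chain_of_length_2:
  assumes C: "primeideal C0 R" "primeideal C1 R" "primeideal C2 R" and sub: "C0 \<subset> C1" "C1 \<subset> C2"
  shows False
proof -
  obtain g0 where g0: "g0 \<in> C0" "\<And>c. c \<in> carrier R \<Longrightarrow> c \<in> C0 \<longleftrightarrow> h g0 dvd h c"
    using prime_membership[OF C(1)] by blast
  obtain g1 where g1: "g1 \<in> C1" "\<And>c. c \<in> carrier R \<Longrightarrow> c \<in> C1 \<longleftrightarrow> h g1 dvd h c"
    using prime_membership[OF C(2)] by blast
  obtain g2 where g2: "g2 \<in> C2" "\<And>c. c \<in> carrier R \<Longrightarrow> c \<in> C2 \<longleftrightarrow> h g2 dvd h c"
    using prime_membership[OF C(3)] by blast
  interpret C0: primeideal C0 R by fact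
  interpret C1: primeideal C1 R by fact
  interpret C2: primeideal C2 R by fact
  have carr: "g1 \<in> carrier R" "g2 \<in> carrier R" using g1(1) g2(1) C1.Icarr C2.Icarr by auto
  have nz: "h g1 \<noteq> 0"
  proof
    assume "h g1 = 0"
    then have "c \<in> C0" if "c \<in> C1" for c
      using that g0(2)[OF C1.Icarr[OF that]] g1(2)[OF C1.Icarr[OF that]] by simp
    with sub show False by blast
  qed
  have "h g2 dvd h g1" using g1(1) g2(2)[OF carr(1)] sub by blast
  then obtain q where q: "h g1 = h g2 * q" by blast
  obtain t where t: "t \<in> carrier R" "h t = q" using h_surj by blast
  have "g2 \<otimes> t \<in> C1" using g1(2)[of "g2 \<otimes> t"] carr t q by (simp add: h_mult)
  then consider "g2 \<in> C1" | "t \<in> C1" using C1.I_prime carr t by blast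
  then show False
  proof cases
    case 1
    then have "h g1 dvd h g2" using g1(2) carr by blast
    then have "c \<in> C1" if "c \<in> C2" for c
      using that g1(2)[OF C2.Icarr[OF that]] g2(2)[OF C2.Icarr[OF that]] dvd_trans by blast
    with sub show False by blast
  next
    case 2
    then obtain s where "q = h g1 * s" using g1(2) t by blast
    with q have "h g1 * (1 - h g2 * s) = 0" by (simp add: algebra_simps)
    with nz have "h g2 * s = 1" by simp
    then have "h g2 dvd 1" by (metis dvd_triv_left)
    then have "\<one> \<in> C2" using g2(2)[of \<one>] by (simp add: h_one)
    then show False using C2.one_imp_carrier C2.I_notcarr by blast
  qed
qed

lemma prime_height_maximal:
  assumes Q: "maximalideal Q R"
  shows "prime_height R Q = 1"
proof (rule antisym)
  show "prime_height R Q \<le> 1"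
    unfolding prime_height_def
  proof (rule SUP_least)
    fix k assume "k \<in> {k. \<exists>C::nat \<Rightarrow> 'a set.
      (\<forall>i\<le>k. primeideal (C i) R) \<and> (\<forall>i<k. C i \<subset> C (Suc i)) \<and> C k = Q}"
    then obtain C :: "nat \<Rightarrow> 'a set" where C: "\<forall>i\<le>k. primeideal (C i) R" "\<forall>i<k. C i \<subset> C (Suc i)"
      by blast
    have "k \<le> 1"
    proof (rule ccontr)
      assume "\<not> k \<le> 1"
      then show False
        using no_prime_chain_of_length_2[of "C 0" "C (Suc 0)" "C (Suc (Suc 0))"] C by auto
    qed
    then show "enat k \<le> 1" by (simp add: one_enat_def)
  qed
  let ?K = "{c \<in> carrier R. h c = 0}"
  interpret Q: primeideal Q R using maximalideal_prime[OF Q] .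
  have "?K \<subseteq> Q"
  proof
    fix c assume c: "c \<in> ?K"
    then obtain N :: nat where "c [^] N = \<zero>" using h_nil by blast
    then show "c \<in> Q" using primeideal_power[OF Q.primeideal, of c N] c Q.zero_closed by simp
  qed
  moreover obtain c where "c \<in> Q" "h c \<noteq> 0" using maximal_image_nonzero[OF Q] .
  ultimately have "?K \<subset> Q" by blast
  then have "1 \<in> {k. \<exists>C::nat \<Rightarrow> 'a set.
      (\<forall>i\<le>k. primeideal (C i) R) \<and> (\<forall>i<k. C i \<subset> C (Suc i)) \<and> C k = Q}"
    using kernel_prime Q.primeideal
    by (intro CollectI exI[of _ "\<lambda>i. if i = 0 then ?K else Q"]) auto
  then have "enat 1 \<le> prime_height R Q"
    unfolding prime_height_def by (intro SUP_upper)
  then show "1 \<le> prime_height R Q" by (simp add: one_enat_def)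
qed

text \<open>Let \<open>a, b\<close> begin a regular sequence in \<open>Q\<close>. Then \<open>a\<close> is not nilpotent, and modulo \<open>a\<close> and
nilpotent elements some power of \<open>b\<close> is killed by an element outside \<open>Q\<close>, namely by a lift of the
part of \<open>h a\<close> that is prime to \<open>Q\<close>. Cancelling \<open>b\<close> puts a power of that element into the ideal
generated by \<open>a\<close>, hence into \<open>Q\<close>.\<close>

lemma regular_sequence_length_le_1:
  assumes Q: "maximalideal Q R" and xs: "regular_sequence R xs" "set xs \<subseteq> Q"
  shows "length xs \<le> 1"
proof (rule ccontr)
  assume len: "\<not> length xs \<le> 1"
  define a b where "a = xs ! 0" and "b = xs ! 1"
  interpret Q: primeideal Q R using maximalideal_prime[OF Q] .
  have "a \<in> set xs" "b \<in> set xs" unfolding a_def b_def using len by (auto intro!: nth_mem)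
  then have ab: "a \<in> Q" "b \<in> Q" using xs(2) by auto
  then have carr: "a \<in> carrier R" "b \<in> carrier R" using Q.Icarr by auto
  have tk: "set (take 1 xs) = {a}" using len by (cases xs) (auto simp: a_def)
  have regular: "\<forall>y\<in>carrier R. xs ! i \<otimes> y \<in> Idl (set (take i xs)) \<longrightarrow> y \<in> Idl (set (take i xs))"
    if "i < length xs" for i
    using xs(1) that unfolding regular_sequence_def by blast
  have rega: "\<forall>y\<in>carrier R. a \<otimes> y \<in> {\<zero>} \<longrightarrow> y \<in> {\<zero>}"
    using regular[of 0] len unfolding a_def take_0 list.set genideal_empty by linarith
  let ?J = "Idl {a}"
  have regb: "\<forall>y\<in>carrier R. b \<otimes> y \<in> ?J \<longrightarrow> y \<in> ?J"
    using regular[of 1] len unfolding tk b_def by linarith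
  have J: "ideal ?J R" "a \<in> ?J" using genideal_ideal genideal_self' carr by auto
  have JQ: "?J \<subseteq> Q" using genideal_minimal[OF Q.is_ideal] ab by auto
  obtain g where g: "g \<in> Q" "\<And>c. c \<in> carrier R \<Longrightarrow> c \<in> Q \<longleftrightarrow> h g dvd h c"
    using prime_membership[OF Q.primeideal] by blast
  have one: "\<one> \<notin> Q" using Q.one_imp_carrier Q.I_notcarr by blast
  have nu: "\<not> h g dvd 1" using g(2)[of \<one>] one by (simp add: h_one)
  have nz: "h a \<noteq> 0"
  proof
    assume "h a = 0"
    then obtain N :: nat where "a [^] N = \<zero>" using h_nil carr by blast
    then have "a [^] N \<otimes> \<one> \<in> {\<zero>}" using carr by simp
    then have "\<one> \<in> {\<zero>}" by (rule power_cancel_mod_ideal[OF carr(1) rega one_closed])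
    then show False using one Q.zero_closed by simp
  qed
  obtain m s where ms: "h a = h g ^ m * s" "\<not> h g dvd s"
    using poly_split_off_power[OF nz nu] by blast
  obtain t where t: "t \<in> carrier R" "h t = s" using h_surj by blast
  obtain r where r: "h b = h g * r" using g(2) ab carr by blast
  \<comment> \<open>a power of \<open>b\<close> times the part of \<open>a\<close> outside \<open>Q\<close> is divisible by \<open>a\<close> up to nilpotents\<close>
  have "h (b [^] m \<otimes> t) = h a * r ^ m"
    using carr t r ms by (simp add: h_mult h_pow power_mult_distrib)
  then obtain N :: nat where "(b [^] m \<otimes> t) [^] N \<in> ?J"
    using power_mem_ideal[OF J, of "b [^] m \<otimes> t"] carr t by auto
  then have "b [^] (m * N) \<otimes> t [^] N \<in> ?J"
    using carr t by (simp add: nat_pow_distrib nat_pow_pow)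
  then have "t [^] N \<in> ?J"
    by (rule power_cancel_mod_ideal[OF carr(2) regb nat_pow_closed[OF t(1)]])
  then have "t \<in> Q" using JQ primeideal_power[OF Q.primeideal t(1)] by blast
  then show False using g(2) t ms by blast
qed

lemma ideal_depth_maximal:
  assumes Q: "maximalideal Q R"
  shows "ideal_depth R Q = 1 \<longleftrightarrow> (\<exists>a\<in>Q. nonzerodivisor R a)"
proof
  interpret Q: maximalideal Q R by fact
  assume depth: "ideal_depth R Q = 1"
  have "\<exists>xs. regular_sequence R xs \<and> set xs \<subseteq> Q \<and> xs \<noteq> []"
  proof (rule ccontr)
    assume "\<not> ?thesis"
    then have "ideal_depth R Q \<le> 0"
      unfolding ideal_depth_def by (intro SUP_least) (auto simp: zero_enat_def)
    with depth show False by simp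
  qed
  then obtain xs where xs: "regular_sequence R xs" "set xs \<subseteq> Q" "xs \<noteq> []" by blast
  then have "nonzerodivisor R (xs ! 0)"
    unfolding regular_sequence_def nonzerodivisor_def
    by (auto simp: genideal_empty dest!: spec[of _ 0])
  with xs show "\<exists>a\<in>Q. nonzerodivisor R a" by (metis length_greater_0_conv nth_mem subsetD)
next
  interpret Q: maximalideal Q R by fact
  assume "\<exists>a\<in>Q. nonzerodivisor R a"
  then obtain a where a: "a \<in> Q" "nonzerodivisor R a" by blast
  have "Idl {a} \<subseteq> Q" using genideal_minimal[OF Q.is_ideal] a by auto
  then have proper: "Idl (set [a]) \<noteq> carrier R"
    using Q.I_notcarr Q.a_subset by auto
  have "regular_sequence R [a]"
    unfolding regular_sequence_def
  proof (intro conjI allI impI ballI proper)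
    show "set [a] \<subseteq> carrier R" using Q.Icarr[OF a(1)] by simp
    fix i y assume "i < length [a]" "y \<in> carrier R" "[a] ! i \<otimes> y \<in> Idl (set (take i [a]))"
    then show "y \<in> Idl (set (take i [a]))"
      using a(2) unfolding nonzerodivisor_def by (auto simp: genideal_empty)
  qed
  then have "enat (length [a]) \<le> ideal_depth R Q"
    unfolding ideal_depth_def using a by (intro SUP_upper) auto
  then have "1 \<le> ideal_depth R Q" by (simp add: one_enat_def)
  moreover have "ideal_depth R Q \<le> 1"
    unfolding ideal_depth_def using regular_sequence_length_le_1[OF Q]
    by (intro SUP_least) (auto simp: one_enat_def)
  ultimately show "ideal_depth R Q = 1" by simp
qed

text \<open>The maximal ideal of the origin contains a nonzerodivisor \<open>a\<close>. Since \<open>h a\<close> is divisible by \<open>X\<close>,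
some power of \<open>a\<close> is a multiple of \<open>x\<close>, so whatever \<open>x\<close> kills is killed by that power.\<close>

lemma cohen_macaulay_imp_nonzerodivisor:
  assumes cm: "cohen_macaulay R" and x: "x \<in> carrier R" "h x = [:0, 1:]"
  shows "nonzerodivisor R x"
proof -
  let ?X = "[:0, 1:] :: 'k poly"
  let ?Q = "{c \<in> carrier R. ?X dvd h c}"
  have unit: "?X dvd p \<longleftrightarrow> poly p 0 = 0" for p :: "'k poly"
    using poly_eq_0_iff_dvd[of p 0] by simp
  have Q: "maximalideal ?Q R"
  proof (rule maximalidealI)
    show "ideal ?Q R" by (rule preimage_ideal)
    have "\<not> ?X dvd h \<one>" unfolding h_one unit by simp
    then have "\<one> \<notin> ?Q" by blast
    then show "carrier R \<noteq> ?Q" using one_closed by blast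
  next
    fix J assume J: "ideal J R" "?Q \<subseteq> J" "J \<subseteq> carrier R"
    interpret J: ideal J R by fact
    show "J = ?Q \<or> J = carrier R"
    proof (cases "J \<subseteq> ?Q")
      case True
      with J show ?thesis by blast
    next
      case False
      then obtain c where c: "c \<in> J" "c \<in> carrier R" "poly (h c) 0 \<noteq> 0"
        using J.Icarr unit by blast
      \<comment> \<open>rescaled by the inverse of its constant term, \<open>c\<close> is congruent to \<open>1\<close>\<close>
      obtain t where t: "t \<in> carrier R" "h t = [:inverse (poly (h c) 0):]" using h_surj by blast
      have "h (\<one> \<ominus> c \<otimes> t) = 1 - h c * [:inverse (poly (h c) 0):]"
        using h_diff[of \<one> "c \<otimes> t"] h_mult[of c t] h_one c(2) t by (metis m_closed one_closed)
      then have "poly (h (\<one> \<ominus> c \<otimes> t)) 0 = 0" using c(3) by simp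
      then have "\<one> \<ominus> c \<otimes> t \<in> ?Q"
        using unit c(2) t(1) minus_closed m_closed one_closed by blast
      then have "(\<one> \<ominus> c \<otimes> t) \<oplus> c \<otimes> t \<in> J"
        using J c t J.I_r_closed J.a_closed by blast
      moreover have "(\<one> \<ominus> c \<otimes> t) \<oplus> c \<otimes> t = \<one>" using c t by algebra
      ultimately have "\<one> \<in> J" by (rule back_subst)
      then show ?thesis using J.one_imp_carrier by blast
    qed
  qed
  have "ideal_depth R ?Q = prime_height R ?Q" using cm Q unfolding cohen_macaulay_def by blast
  then have "ideal_depth R ?Q = 1" unfolding prime_height_maximal[OF Q] .
  then obtain a where a: "a \<in> ?Q" "nonzerodivisor R a" using ideal_depth_maximal[OF Q] by blast
  have carr: "a \<in> carrier R" using a by blast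
  show ?thesis unfolding nonzerodivisor_def
  proof (intro ballI impI)
    fix y assume y: "y \<in> carrier R" "x \<otimes> y = \<zero>"
    let ?J = "Idl {x}"
    have "ideal ?J R" "x \<in> ?J" using genideal_ideal[of "{x}"] genideal_self'[of x] x(1) by auto
    moreover have "h x dvd h a" using a(1) unfolding x(2) by blast
    ultimately obtain N :: nat where "a [^] N \<in> ?J" using power_mem_ideal carr by blast
    then have "a [^] N \<in> PIdl x" using cgenideal_eq_genideal[OF x(1)] by simp
    then obtain z where z: "z \<in> carrier R" "a [^] N = z \<otimes> x" unfolding cgenideal_def by blast
    then have "a [^] N \<otimes> y = \<zero>" using x y by (simp add: m_assoc)
    then show "y = \<zero>"
      using power_cancel_mod_ideal[OF carr, of "{\<zero>}" y N] a(2) y(1)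
      unfolding nonzerodivisor_def singleton_iff by blast
  qed
qed

text \<open>A maximal ideal contains some \<open>c\<close> with nonzero image in \<open>K[X]\<close>, and a nonzerodivisor with the same
image as \<open>c\<close> has a power in that ideal, hence lies in it.\<close>

lemma cohen_macaulay_if_torsion_free:
  assumes "noetherian_ring R"
    and tf: "\<And>p. p \<noteq> 0 \<Longrightarrow> \<exists>a\<in>carrier R. h a = p \<and> nonzerodivisor R a"
  shows "cohen_macaulay R"
  unfolding cohen_macaulay_def
proof (intro conjI allI impI)
  fix Q assume Q: "maximalideal Q R"
  obtain c where c: "c \<in> Q" "h c \<noteq> 0" using maximal_image_nonzero[OF Q] .
  obtain a where a: "a \<in> carrier R" "h a = h c" "nonzerodivisor R a" using tf[OF c(2)] by blast
  have P: "primeideal Q R" using maximalideal_prime[OF Q] .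
  have "ideal Q R" using P by (rule primeideal.axioms(1))
  from power_mem_ideal[OF this c(1) a(1)] a(2) have "\<exists>N::nat. a [^] N \<in> Q" by simp
  then have "a \<in> Q" using primeideal_power[OF P a(1)] by blast
  then show "ideal_depth R Q = prime_height R Q"
    using a ideal_depth_maximal[OF Q] prime_height_maximal[OF Q] by auto
qed (use assms(1) is_cring in auto)

end

section \<open>Finite algebras over a polynomial ring are noetherian\<close>

text \<open>The submodule generated by a list, with scalars acting through \<open>\<iota>\<close>; the list lets induction remove
one generator at a time.\<close>

primrec (in ring) coeff_span :: "('k::field poly \<Rightarrow> 'a) \<Rightarrow> 'a list \<Rightarrow> 'a set" where
  "coeff_span \<iota> [] = {\<zero>}"
| "coeff_span \<iota> (e # es) = {\<iota> p \<otimes> e \<oplus> s | p s. s \<in> coeff_span \<iota> es}"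

locale poly_algebra = cring R for R (structure) +
  fixes \<iota> :: "'k::field poly \<Rightarrow> 'a"
  assumes iota_closed [simp]: "\<iota> p \<in> carrier R"
    and iota_diff: "\<iota> (p - q) = \<iota> p \<ominus> \<iota> q"
    and iota_mult: "\<iota> (p * q) = \<iota> p \<otimes> \<iota> q"
begin

lemma iota_zero: "\<iota> 0 = \<zero>"
  using iota_diff[of 0 0] by (simp add: a_minus_def r_neg)

lemma coeff_span_closed:
  assumes "set es \<subseteq> carrier R"
  shows "coeff_span \<iota> es \<subseteq> carrier R"
  using assms by (induction es) auto

lemma zero_coeff_span:
  assumes "set es \<subseteq> carrier R"
  shows "\<zero> \<in> coeff_span \<iota> es"
  using assms
proof (induction es)
  case (Cons e es)
  have "\<zero> = \<iota> 0 \<otimes> e \<oplus> \<zero>" using Cons.prems by (simp add: iota_zero)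
  moreover have "\<zero> \<in> coeff_span \<iota> es" using Cons by simp
  ultimately show ?case unfolding coeff_span.simps by blast
qed simp

lemma coeff_span_diff:
  assumes "set es \<subseteq> carrier R" "u \<in> coeff_span \<iota> es" "v \<in> coeff_span \<iota> es"
  shows "u \<ominus> v \<in> coeff_span \<iota> es"
  using assms
proof (induction es arbitrary: u v)
  case Nil
  then show ?case by (simp add: a_minus_def)
next
  case (Cons e es)
  then obtain p s q t where u: "u = \<iota> p \<otimes> e \<oplus> s" "s \<in> coeff_span \<iota> es"
    and v: "v = \<iota> q \<otimes> e \<oplus> t" "t \<in> coeff_span \<iota> es" by auto
  have carr: "e \<in> carrier R" "s \<in> carrier R" "t \<in> carrier R"
    using u v Cons.prems(1) coeff_span_closed[of es] by auto
  have "s \<ominus> t \<in> coeff_span \<iota> es" using Cons u v by simp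
  moreover have "u \<ominus> v = \<iota> (p - q) \<otimes> e \<oplus> (s \<ominus> t)"
  proof -
    have "(P \<otimes> e \<oplus> s) \<ominus> (Q \<otimes> e \<oplus> t) = (P \<ominus> Q) \<otimes> e \<oplus> (s \<ominus> t)"
      if "P \<in> carrier R" "Q \<in> carrier R" for P Q
      using that carr by algebra
    then show ?thesis using u v by (simp add: iota_diff)
  qed
  ultimately show ?case by auto
qed

lemma coeff_span_scale:
  assumes "set es \<subseteq> carrier R" "u \<in> coeff_span \<iota> es"
  shows "\<iota> q \<otimes> u \<in> coeff_span \<iota> es"
  using assms
proof (induction es arbitrary: u)
  case Nil
  then show ?case by simp
next
  case (Cons e es)
  then obtain p s where u: "u = \<iota> p \<otimes> e \<oplus> s" "s \<in> coeff_span \<iota> es" by auto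
  have carr: "e \<in> carrier R" "s \<in> carrier R"
    using u Cons.prems(1) coeff_span_closed[of es] by auto
  then have "\<iota> q \<otimes> u = \<iota> (q * p) \<otimes> e \<oplus> \<iota> q \<otimes> s"
    using u by (simp add: iota_mult r_distr m_assoc)
  moreover have "\<iota> q \<otimes> s \<in> coeff_span \<iota> es" using Cons u by simp
  ultimately show ?case by auto
qed

lemma generator_in_coeff_span:
  "\<lbrakk>set es \<subseteq> carrier R; e \<in> set es\<rbrakk> \<Longrightarrow> \<iota> p \<otimes> e \<in> coeff_span \<iota> es"
proof (induction es)
  case (Cons d es)
  have carr: "d \<in> carrier R" "e \<in> carrier R" "set es \<subseteq> carrier R" using Cons.prems by auto
  show ?case
  proof (cases "e = d")
    case True
    then have "\<iota> p \<otimes> e = \<iota> p \<otimes> d \<oplus> \<zero>" using carr by simp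
    then show ?thesis using zero_coeff_span[OF carr(3)] unfolding coeff_span.simps by blast
  next
    case False
    then have "\<iota> p \<otimes> e \<in> coeff_span \<iota> es" using Cons by auto
    moreover have "\<iota> p \<otimes> e = \<iota> 0 \<otimes> d \<oplus> \<iota> p \<otimes> e" using carr by (simp add: iota_zero)
    ultimately show ?thesis unfolding coeff_span.simps by blast
  qed
qed simp

text \<open>The usual argument that submodules of a finitely generated module over a principal ideal domain are
finitely generated: the coefficients of the first generator form a principal ideal of \<open>K[X]\<close>, and
one element attaining its generator reduces the problem to the remaining generators.\<close>

lemma ideal_in_span_finitely_generated:
  assumes W: "ideal W R" and es: "set es \<subseteq> carrier R"
  shows "\<exists>F. finite F \<and> F \<subseteq> W \<and> W \<inter> coeff_span \<iota> es \<subseteq> Idl F"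
  using es
proof (induction es)
  case Nil
  have "{\<zero>} \<subseteq> Idl {}" by (simp add: genideal_empty)
  then show ?case by (intro exI[of _ "{}"]) auto
next
  case (Cons e es)
  interpret W: ideal W R by fact
  have e: "e \<in> carrier R" and es: "set es \<subseteq> carrier R" using Cons.prems by auto
  obtain F where F: "finite F" "F \<subseteq> W" "W \<inter> coeff_span \<iota> es \<subseteq> Idl F" using Cons by auto
  define L where "L = {p. \<exists>s\<in>coeff_span \<iota> es. \<iota> p \<otimes> e \<oplus> s \<in> W}"
  have "\<exists>g\<in>L. \<forall>p\<in>L. g dvd p"
  proof (rule poly_ideal_principal)
    have "\<iota> 0 \<otimes> e \<oplus> \<zero> \<in> W" using e W.zero_closed by (simp add: iota_zero)
    then have "0 \<in> L" unfolding L_def using zero_coeff_span[OF es] by blast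
    then show "L \<noteq> {}" by blast
  next
    fix p q assume "p \<in> L" "q \<in> L"
    then obtain s t where st: "s \<in> coeff_span \<iota> es" "\<iota> p \<otimes> e \<oplus> s \<in> W"
      "t \<in> coeff_span \<iota> es" "\<iota> q \<otimes> e \<oplus> t \<in> W" unfolding L_def by blast
    have carr: "s \<in> carrier R" "t \<in> carrier R" using st coeff_span_closed[OF es] by auto
    have "(\<iota> p \<otimes> e \<oplus> s) \<ominus> (\<iota> q \<otimes> e \<oplus> t) \<in> W"
      using st(2,4) W.a_closed W.a_inv_closed by (simp add: a_minus_def)
    moreover have "(P \<otimes> e \<oplus> s) \<ominus> (Q \<otimes> e \<oplus> t) = (P \<ominus> Q) \<otimes> e \<oplus> (s \<ominus> t)"
      if "P \<in> carrier R" "Q \<in> carrier R" for P Q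
      using that carr e by algebra
    ultimately have "\<iota> (p - q) \<otimes> e \<oplus> (s \<ominus> t) \<in> W" by (simp add: iota_diff)
    then show "p - q \<in> L" unfolding L_def using coeff_span_diff[OF es st(1,3)] by blast
  next
    fix p q assume "p \<in> L"
    then obtain s where s: "s \<in> coeff_span \<iota> es" "\<iota> p \<otimes> e \<oplus> s \<in> W" unfolding L_def by blast
    have carr: "s \<in> carrier R" using s coeff_span_closed[OF es] by auto
    have "\<iota> q \<otimes> (\<iota> p \<otimes> e \<oplus> s) \<in> W" using s W.I_l_closed by simp
    moreover have "\<iota> q \<otimes> (\<iota> p \<otimes> e \<oplus> s) = \<iota> (p * q) \<otimes> e \<oplus> \<iota> q \<otimes> s"
      using carr e by (simp add: iota_mult r_distr m_assoc m_lcomm)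
    ultimately show "p * q \<in> L" unfolding L_def using coeff_span_scale[OF es s(1)] by auto
  qed
  then obtain g where g: "g \<in> L" "\<forall>p\<in>L. g dvd p" by blast
  then obtain s0 where s0: "s0 \<in> coeff_span \<iota> es" "\<iota> g \<otimes> e \<oplus> s0 \<in> W" unfolding L_def by blast
  define w0 where "w0 = \<iota> g \<otimes> e \<oplus> s0"
  have s0c: "s0 \<in> carrier R" using s0 coeff_span_closed[OF es] by auto
  have w0: "w0 \<in> W" "w0 \<in> carrier R" using s0 W.Icarr by (auto simp: w0_def)
  have FC: "insert w0 F \<subseteq> carrier R" using F w0 W.Icarr by auto
  interpret G: ideal "Idl (insert w0 F)" R using genideal_ideal[OF FC] .
  have sub: "Idl F \<subseteq> Idl (insert w0 F)" and w0G: "w0 \<in> Idl (insert w0 F)"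
    using subset_Idl_subset[OF FC, of F] genideal_self[OF FC] by auto
  have "w \<in> Idl (insert w0 F)" if w: "w \<in> W" "w \<in> coeff_span \<iota> (e # es)" for w
  proof -
    obtain p s where ps: "w = \<iota> p \<otimes> e \<oplus> s" "s \<in> coeff_span \<iota> es" using w by auto
    have sc: "s \<in> carrier R" using ps coeff_span_closed[OF es] by auto
    have "p \<in> L" unfolding L_def using ps w by blast
    then obtain q where q: "p = q * g" using g(2) by (metis dvd_def mult.commute)
    \<comment> \<open>subtracting a multiple of \<open>w0\<close> removes the coefficient of \<open>e\<close>\<close>
    have eq: "w \<ominus> \<iota> q \<otimes> w0 = s \<ominus> \<iota> q \<otimes> s0"
    proof -
      have "((Q \<otimes> G) \<otimes> e \<oplus> s) \<ominus> Q \<otimes> (G \<otimes> e \<oplus> s0) = s \<ominus> Q \<otimes> s0"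
        if "Q \<in> carrier R" "G \<in> carrier R" for Q G
        using that e sc s0c by algebra
      then show ?thesis using ps q by (simp add: w0_def iota_mult)
    qed
    have "s \<ominus> \<iota> q \<otimes> s0 \<in> coeff_span \<iota> es"
      using coeff_span_diff[OF es ps(2) coeff_span_scale[OF es s0(1)]] .
    moreover have "w \<ominus> \<iota> q \<otimes> w0 \<in> W"
      using w(1) w0 W.I_l_closed[of w0 "\<iota> q"] W.a_closed W.a_inv_closed by (simp add: a_minus_def)
    ultimately have "w \<ominus> \<iota> q \<otimes> w0 \<in> Idl (insert w0 F)" using eq F(3) sub by auto
    moreover have "\<iota> q \<otimes> w0 \<in> Idl (insert w0 F)" using w0G G.I_l_closed by simp
    ultimately have "(w \<ominus> \<iota> q \<otimes> w0) \<oplus> \<iota> q \<otimes> w0 \<in> Idl (insert w0 F)" using G.a_closed by blast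
    moreover have "(w \<ominus> Q \<otimes> w0) \<oplus> Q \<otimes> w0 = w" if "Q \<in> carrier R" for Q
      using that W.Icarr[OF w(1)] w0(2) by algebra
    ultimately show ?thesis by simp
  qed
  then show ?case using F w0 by (intro exI[of _ "insert w0 F"]) blast
qed

lemma noetherian_if_finitely_spanned:
  assumes es: "set es \<subseteq> carrier R" and span: "carrier R \<subseteq> coeff_span \<iota> es"
  shows "noetherian_ring R"
proof (rule noetherian_ringI)
  fix W assume W: "ideal W R"
  obtain F where F: "finite F" "F \<subseteq> W" "W \<inter> coeff_span \<iota> es \<subseteq> Idl F"
    using ideal_in_span_finitely_generated[OF W es] by blast
  have Wc: "W \<subseteq> carrier R" using ideal.Icarr[OF W] by blast
  then have "W = Idl F" using F span genideal_minimal[OF W F(2)] by blast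
  then show "\<exists>A\<subseteq>carrier R. finite A \<and> W = Idl A" using F Wc by blast
qed

end


section \<open>Linear functionals on polynomials in four variables\<close>

lemma poly_mapping_induct_single [case_names single add]:
  assumes single: "\<And>u c. P (Poly_Mapping.single u c)"
    and add: "\<And>f g. P f \<Longrightarrow> P g \<Longrightarrow> P (f + g)"
  shows "P (f :: 'b \<Rightarrow>\<^sub>0 'c::monoid_add)"
proof (induction f rule: update_induct)
  case const
  show ?case using single[of undefined 0] by simp
next
  case (update f a b)
  then have "Poly_Mapping.update a b f = Poly_Mapping.single a b + f"
    by (intro poly_mapping_eqI)
      (auto simp: lookup_update lookup_add lookup_single when_def in_keys_iff)
  with update single add show ?case by metis
qed

lemma poly_mapping_as_sum:
  "f = (\<Sum>u\<in>Poly_Mapping.keys f. Poly_Mapping.single u (Poly_Mapping.lookup f u))"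
  by (rule poly_mapping_eqI)
    (auto simp: lookup_sum lookup_single when_def sum.delta in_keys_iff cong: if_cong)

text \<open>The linear extension of a map on monomials. The parametrization, the restriction to an axis, the map
with kernel the ideal of initial forms and the indicator functionals of sets of monomials are all of
this shape.\<close>

definition lin_ext :: "((4 \<Rightarrow>\<^sub>0 nat) \<Rightarrow> 'k poly) \<Rightarrow> 'k::field poly4 \<Rightarrow> 'k poly" where
  "lin_ext g f = (\<Sum>u\<in>Poly_Mapping.keys f. Polynomial.smult (Poly_Mapping.lookup f u) (g u))"

lemma lin_ext_superset:
  assumes "finite A" "Poly_Mapping.keys f \<subseteq> A"
  shows "lin_ext g f = (\<Sum>u\<in>A. Polynomial.smult (Poly_Mapping.lookup f u) (g u))"
  unfolding lin_ext_def using assms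
  by (intro sum.mono_neutral_left) (auto simp: in_keys_iff)

lemma coeff_lin_ext:
  "Polynomial.coeff (lin_ext g f) k =
    (\<Sum>u\<in>Poly_Mapping.keys f. Poly_Mapping.lookup f u * Polynomial.coeff (g u) k)"
  by (simp add: lin_ext_def Polynomial.coeff_sum)

lemma lin_ext_0 [simp]: "lin_ext g 0 = 0"
  by (simp add: lin_ext_def)

lemma lin_ext_single [simp]: "lin_ext g (Poly_Mapping.single u c) = Polynomial.smult c (g u)"
  by (simp add: lin_ext_def)

lemma lin_ext_add [simp]: "lin_ext g (f1 + f2) = lin_ext g f1 + lin_ext g f2"
proof -
  let ?A = "Poly_Mapping.keys f1 \<union> Poly_Mapping.keys f2"
  have "lin_ext g f = (\<Sum>u\<in>?A. Polynomial.smult (Poly_Mapping.lookup f u) (g u))"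
    if "f \<in> {f1, f2, f1 + f2}" for f
    using that keys_add[of f1 f2] by (intro lin_ext_superset) auto
  then show ?thesis by (simp add: lookup_add smult_add_left sum.distrib)
qed

lemma lin_ext_diff [simp]: "lin_ext g (f1 - f2) = lin_ext g f1 - lin_ext g f2"
  using lin_ext_add[of g "f1 - f2" f2] by simp

lemma lin_ext_mult_single:
  "lin_ext g (Poly_Mapping.single v c * f) = Polynomial.smult c (lin_ext (\<lambda>u. g (v + u)) f)"
proof (induction f rule: poly_mapping_induct_single)
  case (single u d)
  then show ?case by (simp add: mult_single)
next
  case (add f1 f2)
  then show ?case by (simp add: distrib_left smult_add_right)
qed

lemma lin_ext_cong:
  "(\<And>u. u \<in> Poly_Mapping.keys f \<Longrightarrow> g u = g' u) \<Longrightarrow> lin_ext g f = lin_ext g' f"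
  unfolding lin_ext_def by (rule sum.cong) auto

lemma lin_ext_mult:
  assumes "\<And>u v. g (u + v) = g u * g v"
  shows "lin_ext g (f1 * f2) = lin_ext g f1 * lin_ext g f2"
proof (induction f1 rule: poly_mapping_induct_single)
  case (single u c)
  show ?case
  proof (induction f2 rule: poly_mapping_induct_single)
    case (single v d)
    then show ?case by (simp add: mult_single assms mult.commute)
  next
    case (add f g)
    then show ?case by (simp add: distrib_left)
  qed
next
  case (add f g)
  then show ?case by (simp add: distrib_right)
qed


section \<open>Ideals and quotients of the polynomial ring\<close>

lemma type_ring_simps [simp]:
  "carrier ring_of_type_algebra = (UNIV :: 'r::comm_ring_1 set)"
  "a \<otimes>\<^bsub>ring_of_type_algebra\<^esub> b = a * b" "a \<oplus>\<^bsub>ring_of_type_algebra\<^esub> b = a + (b :: 'r)"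
  "\<one>\<^bsub>ring_of_type_algebra\<^esub> = (1 :: 'r)" "\<zero>\<^bsub>ring_of_type_algebra\<^esub> = (0 :: 'r)"
  by (auto simp: ring_of_type_algebra_def)

lemma type_ring_minus [simp]: "a \<ominus>\<^bsub>ring_of_type_algebra\<^esub> b = a - (b :: 'r::comm_ring_1)"
proof -
  interpret R: cring "ring_of_type_algebra :: 'r ring" by (rule cring_from_type_algebra)
  have "\<ominus>\<^bsub>ring_of_type_algebra\<^esub> b = - b"
    using R.minus_equality[of "- b" b] by simp
  then show ?thesis by (simp add: a_minus_def)
qed

lemma type_ring_idealI:
  fixes J :: "'r::comm_ring_1 set"
  assumes "0 \<in> J" "\<And>a b. a \<in> J \<Longrightarrow> b \<in> J \<Longrightarrow> a + b \<in> J" "\<And>r a. a \<in> J \<Longrightarrow> r * a \<in> J"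
  shows "ideal J ring_of_type_algebra"
proof -
  interpret R: cring "ring_of_type_algebra :: 'r ring" by (rule cring_from_type_algebra)
  have neg: "\<ominus>\<^bsub>ring_of_type_algebra\<^esub> a = - a" for a :: 'r
    using R.minus_equality[of "- a" a] by simp
  show ?thesis
  proof (rule idealI)
    show "subgroup J (add_monoid ring_of_type_algebra)"
    proof (rule R.add.subgroupI)
      fix a assume "a \<in> J"
      then show "\<ominus>\<^bsub>ring_of_type_algebra\<^esub> a \<in> J" using assms(3)[of a "- 1"] by (simp add: neg)
    qed (use assms in auto)
    fix a r :: 'r assume "a \<in> J"
    then show "r \<otimes>\<^bsub>ring_of_type_algebra\<^esub> a \<in> J" "a \<otimes>\<^bsub>ring_of_type_algebra\<^esub> r \<in> J"
      using assms(3)[of a r] by (auto simp: mult.commute)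
  qed (rule R.ring_axioms)
qed

context
  fixes J :: "'r::comm_ring_1 set"
  assumes J: "ideal J ring_of_type_algebra"
begin

interpretation R: cring "ring_of_type_algebra :: 'r ring" by (rule cring_from_type_algebra)
interpretation J: ideal J "ring_of_type_algebra" by (rule J)

lemma type_ideal_zero: "0 \<in> J"
  using J.zero_closed by simp

lemma type_ideal_add: "a \<in> J \<Longrightarrow> b \<in> J \<Longrightarrow> a + b \<in> J"
  using J.a_closed[of a b] by simp

lemma type_ideal_mult: "a \<in> J \<Longrightarrow> r * a \<in> J"
  using J.I_l_closed[of a r] by simp

lemma type_ideal_sum: "(\<And>x. x \<in> A \<Longrightarrow> f x \<in> J) \<Longrightarrow> sum f A \<in> J"
  by (induction A rule: infinite_finite_induct) (auto simp: type_ideal_zero type_ideal_add)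

private abbreviation (input) "Q \<equiv> ring_of_type_algebra Quot J"
private abbreviation (input) "cls \<equiv> (+>\<^bsub>ring_of_type_algebra\<^esub>) J"

lemma quot_cring: "cring Q"
  by (rule J.quotient_is_cring[OF R.is_cring])

lemma quot_carrier: "carrier Q = range cls"
  by (auto simp: FactRing_def A_RCOSETS_def RCOSETS_def a_r_coset_def)

lemma quot_hom:
  "cls f \<otimes>\<^bsub>Q\<^esub> cls g = cls (f * g)" "cls f \<oplus>\<^bsub>Q\<^esub> cls g = cls (f + g)"
  "\<one>\<^bsub>Q\<^esub> = cls 1" "\<zero>\<^bsub>Q\<^esub> = cls 0"
  using ring_hom_mult[OF J.rcos_ring_hom, of f g] ring_hom_add[OF J.rcos_ring_hom, of f g]
    ring_hom_one[OF J.rcos_ring_hom] R.a_rcos_zero[OF J type_ideal_zero]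
  by (auto simp: FactRing_def)

lemma quot_eq_iff: "cls f = cls g \<longleftrightarrow> f - g \<in> J"
  using R.quotient_eq_iff_same_a_r_cos[OF J, of f g] by simp

lemma quot_eq_zero_iff: "cls f = \<zero>\<^bsub>Q\<^esub> \<longleftrightarrow> f \<in> J"
  by (simp add: quot_hom quot_eq_iff)

lemma quot_minus: "cls f \<ominus>\<^bsub>Q\<^esub> cls g = cls (f - g)"
proof -
  interpret Q: cring Q by (rule quot_cring)
  have c: "cls x \<in> carrier Q" for x by (auto simp: quot_carrier)
  have "(cls f \<ominus>\<^bsub>Q\<^esub> cls g) = (cls (f - g) \<oplus>\<^bsub>Q\<^esub> cls g) \<ominus>\<^bsub>Q\<^esub> cls g" by (simp add: quot_hom)
  also have "\<dots> = cls (f - g)" using c[of "f - g"] c[of g] by algebra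
  finally show ?thesis .
qed

lemma quot_pow: "cls f [^]\<^bsub>Q\<^esub> (k::nat) = cls (f ^ k)"
  by (induction k) (auto simp: quot_hom nat_pow_def mult.commute)

lemma quot_nonzerodivisor_iff: "nonzerodivisor Q (cls a) \<longleftrightarrow> (\<forall>f. a * f \<in> J \<longrightarrow> f \<in> J)"
  by (auto simp: nonzerodivisor_def quot_carrier quot_hom(1) quot_eq_zero_iff)

end


section \<open>Exponent vectors\<close>

lemma UNIV_4: "(UNIV :: 4 set) = {1, 2, 3, 4}"
proof -
  have "card {1, 2, 3, 4 :: 4} = card (UNIV :: 4 set)" by simp
  then show ?thesis by (intro card_subset_eq[symmetric]) auto
qed

lemma four_cases: "(i::4) = 1 \<or> i = 2 \<or> i = 3 \<or> i = 4"
  using UNIV_4 by auto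

lemma sum_4: "sum f (UNIV :: 4 set) = f 1 + f 2 + f 3 + f 4"
  unfolding UNIV_4 by (simp add: ac_simps)

abbreviation ev :: "(4 \<Rightarrow>\<^sub>0 nat) \<Rightarrow> 4 \<Rightarrow> nat" where
  "ev \<equiv> Poly_Mapping.lookup"

definition expo :: "nat \<Rightarrow> nat \<Rightarrow> nat \<Rightarrow> nat \<Rightarrow> 4 \<Rightarrow>\<^sub>0 nat" where
  "expo a b c d = Poly_Mapping.single 1 a + Poly_Mapping.single 2 b
     + Poly_Mapping.single 3 c + Poly_Mapping.single 4 d"

lemma ev_expo [simp]:
  "ev (expo a b c d) 1 = a" "ev (expo a b c d) 2 = b"
  "ev (expo a b c d) 3 = c" "ev (expo a b c d) 4 = d"
  by (auto simp: expo_def lookup_add lookup_single when_def)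

lemma lookup_exponent_single [simp]: "ev (Poly_Mapping.single i k) j = (if i = j then k else 0)"
  by (simp add: lookup_single when_def)

lemma expo_eqI:
  assumes "ev u 1 = ev v 1" "ev u 2 = ev v 2" "ev u 3 = ev v 3" "ev u 4 = ev v 4"
  shows "u = v"
  by (rule poly_mapping_eqI) (use four_cases assms in metis)

lemma expo_ev: "u = expo (ev u 1) (ev u 2) (ev u 3) (ev u 4)"
  by (rule expo_eqI) auto

lemma expo_add: "expo a b c d + expo a' b' c' d' = expo (a + a') (b + b') (c + c') (d + d')"
  by (rule expo_eqI) (auto simp: lookup_add)

lemma expo_inject [simp]:
  "expo a b c d = expo a' b' c' d' \<longleftrightarrow> a = a' \<and> b = b' \<and> c = c' \<and> d = d'"
  by (metis ev_expo)

lemma monom4_mult: "monom4 u * monom4 v = monom4 (u + v)"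
  by (simp add: monom4_def mult_single)

lemma Var_power: "Var i ^ k = (monom4 (Poly_Mapping.single i k) :: 'k::field poly4)"
proof (induction k)
  case 0
  then show ?case by (simp add: monom4_def)
next
  case (Suc k)
  have "Poly_Mapping.single i 1 + Poly_Mapping.single i k = Poly_Mapping.single i (Suc k)"
    by (simp flip: single_add)
  with Suc show ?case by (simp add: Var_def monom4_mult)
qed

lemma mdeg_ev: "mdeg u = ev u 1 + ev u 2 + ev u 3 + ev u 4"
  by (simp add: mdeg_def sum_4)

lemma mdeg_add [simp]: "mdeg (u + v) = mdeg u + mdeg v"
  by (simp add: mdeg_ev lookup_add)

definition wt :: "(4 \<Rightarrow> nat) \<Rightarrow> (4 \<Rightarrow>\<^sub>0 nat) \<Rightarrow> nat" where
  "wt n u = (\<Sum>i\<in>UNIV. ev u i * n i)"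

lemma wt_ev: "wt n u = ev u 1 * n 1 + ev u 2 * n 2 + ev u 3 * n 3 + ev u 4 * n 4"
  by (simp add: wt_def sum_4)

lemma wt_add [simp]: "wt n (u + v) = wt n u + wt n v"
  by (simp add: wt_ev lookup_add algebra_simps)


section \<open>Restriction to the first coordinate axis\<close>

definition axis_restriction :: "'k::field poly4 \<Rightarrow> 'k poly" where
  "axis_restriction = lin_ext (\<lambda>u.
     if ev u 2 = 0 \<and> ev u 3 = 0 \<and> ev u 4 = 0 then Polynomial.monom 1 (ev u 1) else 0)"

lemma axis_restriction_mult:
  "axis_restriction (f * g) = axis_restriction f * axis_restriction g"
  unfolding axis_restriction_def by (rule lin_ext_mult) (auto simp: lookup_add Polynomial.mult_monom)

lemma axis_restriction_add: "axis_restriction (f + g) = axis_restriction f + axis_restriction g"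
  by (simp add: axis_restriction_def)

lemma axis_restriction_diff: "axis_restriction (f - g) = axis_restriction f - axis_restriction g"
  by (simp add: axis_restriction_def)

lemma axis_restriction_const: "axis_restriction (Poly_Mapping.single 0 c) = [:c:]"
  by (simp add: axis_restriction_def monom_0)

lemma axis_restriction_one: "axis_restriction 1 = 1"
  using axis_restriction_const[of 1] by (simp add: one_pCons)

lemma axis_restriction_Var_1: "axis_restriction (Var 1) = [:0, 1:]"
  by (simp add: axis_restriction_def Var_def monom4_def monom_Suc[of 1 0, simplified] monom_0)

lemma axis_restriction_coeff:
  assumes "ev u 2 = 0" "ev u 3 = 0" "ev u 4 = 0"
  shows "Polynomial.coeff (axis_restriction f) (ev u 1) = Poly_Mapping.lookup f u"
proof -
  have "Polynomial.coeff (axis_restriction f) (ev u 1) =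
      (\<Sum>v\<in>Poly_Mapping.keys f. if v = u then Poly_Mapping.lookup f v else 0)"
    unfolding axis_restriction_def coeff_lin_ext
    by (rule sum.cong) (auto simp: assms intro: expo_eqI)
  also have "\<dots> = Poly_Mapping.lookup f u" by (simp add: sum.delta' in_keys_iff)
  finally show ?thesis .
qed

definition poly_in_x1 :: "'k::field poly \<Rightarrow> 'k poly4" where
  "poly_in_x1 p = poly (map_poly (Poly_Mapping.single 0) p) (Var 1)"

lemma poly_in_x1_pCons:
  "poly_in_x1 (pCons c p) = Poly_Mapping.single 0 c + Var 1 * poly_in_x1 p"
  by (simp add: poly_in_x1_def map_poly_pCons)

lemma poly_in_x1_0 [simp]: "poly_in_x1 0 = 0"
  by (simp add: poly_in_x1_def)

lemma poly_in_x1_X: "poly_in_x1 [:0, 1:] = Var 1"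
  by (simp add: poly_in_x1_pCons)

lemma poly_in_x1_add: "poly_in_x1 (p + q) = poly_in_x1 p + poly_in_x1 q"
proof (induction p q rule: poly_induct2)
  case (pCons a p b q)
  then show ?case by (simp add: poly_in_x1_pCons single_add algebra_simps)
qed simp

lemma poly_in_x1_diff: "poly_in_x1 (p - q) = poly_in_x1 p - poly_in_x1 q"
  using poly_in_x1_add[of "p - q" q] by simp

lemma poly_in_x1_smult: "poly_in_x1 (Polynomial.smult c q) = Poly_Mapping.single 0 c * poly_in_x1 q"
proof (induction q)
  case (pCons a q)
  have "Poly_Mapping.single 0 (c * a) = Poly_Mapping.single 0 c * (Poly_Mapping.single 0 a :: 'a poly4)"
    by (simp add: mult_single)
  with pCons show ?case by (simp add: poly_in_x1_pCons algebra_simps)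
qed simp

lemma poly_in_x1_mult: "poly_in_x1 (p * q) = poly_in_x1 p * poly_in_x1 q"
proof (induction p)
  case (pCons a p)
  then show ?case
    by (simp add: poly_in_x1_pCons poly_in_x1_add poly_in_x1_smult algebra_simps)
qed simp

lemma poly_in_x1_monom:
  "poly_in_x1 (Polynomial.monom c k) = Poly_Mapping.single (Poly_Mapping.single 1 k) c"
proof (induction k)
  case 0
  then show ?case by (simp add: monom_0 poly_in_x1_pCons)
next
  case (Suc k)
  have "Poly_Mapping.single 1 1 + Poly_Mapping.single 1 k = (Poly_Mapping.single 1 (Suc k) :: 4 \<Rightarrow>\<^sub>0 nat)"
    by (simp flip: single_add)
  with Suc show ?case by (simp add: monom_Suc poly_in_x1_pCons Var_def monom4_def mult_single)
qed

lemma axis_restriction_poly_in_x1: "axis_restriction (poly_in_x1 p) = p"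
  by (induction p)
    (auto simp: poly_in_x1_pCons axis_restriction_add axis_restriction_mult axis_restriction_const
      axis_restriction_Var_1, simp add: axis_restriction_def)

text \<open>The total degree in \<open>x2, x3, x4\<close> is additive, and restriction to the axis detects its vanishing.\<close>

lemma axis_kernel_power:
  assumes "axis_restriction f = 0" "u \<in> Poly_Mapping.keys (f ^ k)"
  shows "k \<le> ev u 2 + ev u 3 + ev u 4"
  using assms(2)
proof (induction k arbitrary: u)
  case 0
  then show ?case by simp
next
  case (Suc k)
  then obtain a b where ab: "u = a + b" "a \<in> Poly_Mapping.keys f" "b \<in> Poly_Mapping.keys (f ^ k)"
    using keys_mult[of f "f ^ k"] by auto
  have "\<not> (ev a 2 = 0 \<and> ev a 3 = 0 \<and> ev a 4 = 0)"
    using axis_restriction_coeff[of a f] ab(2) assms(1) by (auto simp: in_keys_iff)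
  then have "1 \<le> ev a 2 + ev a 3 + ev a 4" by linarith
  moreover have "k \<le> ev b 2 + ev b 3 + ev b 4" using Suc.IH[OF ab(3)] .
  ultimately show ?case using ab(1) by (simp add: lookup_add)
qed


section \<open>Cohen--Macaulay quotients of the polynomial ring with one-dimensional support\<close>

text \<open>The support of the quotient by \<open>J\<close> is the whole \<open>x1\<close>-axis: \<open>J\<close> is contained in the ideal of the axis
and contains a power of each of the other variables.\<close>

locale axis_thickening =
  fixes J :: "'k::field poly4 set" and N :: nat
  assumes ideal: "ideal J poly4_ring"
    and vanishes: "f \<in> J \<Longrightarrow> axis_restriction f = 0"
    and nilpotent: "i \<noteq> 1 \<Longrightarrow> Var i ^ N \<in> J"
begin

lemmas J_mult = type_ideal_mult[OF ideal]
  and J_sum = type_ideal_sum[OF ideal]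

abbreviation R where "R \<equiv> poly4_ring Quot J"

definition cls :: "'k poly4 \<Rightarrow> 'k poly4 set" where
  "cls f = J +>\<^bsub>poly4_ring\<^esub> f"

text \<open>The map induced on cosets by the restriction to the axis; \<open>axis_map_cls\<close> shows that the choice of a
representative does not matter.\<close>

definition axis_map :: "'k poly4 set \<Rightarrow> 'k poly" where
  "axis_map A = axis_restriction (SOME f. A = cls f)"

lemma R_carrier: "carrier R = range cls"
  using quot_carrier[OF ideal] unfolding cls_def .

lemma cls_carrier [simp]: "cls f \<in> carrier R"
  by (simp add: R_carrier)

lemmas R_hom = quot_hom[OF ideal, folded cls_def]
  and cls_eq_iff = quot_eq_iff[OF ideal, folded cls_def]
  and cls_zero_iff = quot_eq_zero_iff[OF ideal, folded cls_def]
  and cls_minus = quot_minus[OF ideal, folded cls_def]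
  and cls_pow = quot_pow[OF ideal, folded cls_def]
  and cls_nonzerodivisor_iff = quot_nonzerodivisor_iff[OF ideal, folded cls_def]

lemma axis_map_cls: "axis_map (cls f) = axis_restriction f"
proof -
  have "cls f = cls (SOME g. cls f = cls g)" by (rule someI) (rule refl)
  then have "axis_restriction (f - (SOME g. cls f = cls g)) = 0"
    using cls_eq_iff vanishes by blast
  then show ?thesis by (simp add: axis_map_def axis_restriction_diff)
qed

lemma big_monomial_in_J:
  assumes "i \<noteq> 1" "N \<le> ev u i"
  shows "Poly_Mapping.single u c \<in> J"
proof -
  have "u = (u - Poly_Mapping.single i N) + Poly_Mapping.single i N"
    using assms(2) by (intro poly_mapping_eqI) (auto simp: lookup_add lookup_minus)
  then have "Poly_Mapping.single u c = Poly_Mapping.single (u - Poly_Mapping.single i N) c * Var i ^ N"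
    by (simp add: Var_power monom4_def mult_single)
  then show ?thesis using J_mult nilpotent[OF assms(1)] by simp
qed

lemma axis_kernel_nilpotent:
  assumes "axis_restriction f = 0"
  shows "f ^ (3 * N) \<in> J"
proof -
  have "Poly_Mapping.single u (Poly_Mapping.lookup (f ^ (3 * N)) u) \<in> J"
    if "u \<in> Poly_Mapping.keys (f ^ (3 * N))" for u
  proof -
    have "N \<le> ev u 2 \<or> N \<le> ev u 3 \<or> N \<le> ev u 4"
      using axis_kernel_power[OF assms that] by linarith
    then show ?thesis using big_monomial_in_J[of 2] big_monomial_in_J[of 3] big_monomial_in_J[of 4]
      by auto
  qed
  then show ?thesis by (subst poly_mapping_as_sum) (rule J_sum)
qed

sublocale nilpotent_thickening R axis_map
proof -
  interpret cring R by (rule quot_cring[OF ideal])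
  show "nilpotent_thickening R axis_map"
  proof
    fix p :: "'k poly"
    show "\<exists>a\<in>carrier R. axis_map a = p"
      using axis_map_cls[of "poly_in_x1 p"] axis_restriction_poly_in_x1[of p] cls_carrier by metis
  next
    fix a assume "a \<in> carrier R" "axis_map a = 0"
    then obtain f where f: "a = cls f" "axis_restriction f = 0"
      by (auto simp: R_carrier axis_map_cls)
    then show "\<exists>N::nat. a [^]\<^bsub>R\<^esub> N = \<zero>\<^bsub>R\<^esub>"
      using axis_kernel_nilpotent cls_pow cls_zero_iff by metis
  qed (auto simp: R_carrier R_hom axis_map_cls axis_restriction_add axis_restriction_mult
      axis_restriction_one)
qed

sublocale poly_algebra R "\<lambda>p. cls (poly_in_x1 p)"
  by unfold_locales (auto simp: R_hom cls_minus poly_in_x1_diff poly_in_x1_mult)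

lemma noetherian: "noetherian_ring R"
proof -
  let ?\<iota> = "\<lambda>p. cls (poly_in_x1 p)"
  define es where
    "es = map (\<lambda>(b, c, d). cls (monom4 (expo 0 b c d))) (List.product [0..<N] (List.product [0..<N] [0..<N]))"
  have es: "set es \<subseteq> carrier R" by (auto simp: es_def)
  have "cls f \<in> coeff_span ?\<iota> es" for f
  proof (induction f rule: poly_mapping_induct_single)
    case (single u c)
    show ?case
    proof (cases "ev u 2 < N \<and> ev u 3 < N \<and> ev u 4 < N")
      case True
      then have "cls (monom4 (expo 0 (ev u 2) (ev u 3) (ev u 4))) \<in> set es"
        unfolding es_def by force
      then have "?\<iota> (Polynomial.monom c (ev u 1)) \<otimes>\<^bsub>R\<^esub> cls (monom4 (expo 0 (ev u 2) (ev u 3) (ev u 4)))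
          \<in> coeff_span ?\<iota> es"
        by (rule generator_in_coeff_span[OF es])
      moreover have "Poly_Mapping.single 1 (ev u 1) + expo 0 (ev u 2) (ev u 3) (ev u 4) = u"
        by (rule expo_eqI) (auto simp: lookup_add)
      ultimately show ?thesis by (simp add: R_hom poly_in_x1_monom monom4_def mult_single)
    next
      case False
      then have "Poly_Mapping.single u c \<in> J"
        using big_monomial_in_J[of 2 u c] big_monomial_in_J[of 3 u c] big_monomial_in_J[of 4 u c]
        by fastforce
      then have "cls (Poly_Mapping.single u c) = \<zero>\<^bsub>R\<^esub>" by (simp only: cls_zero_iff)
      then show ?thesis using zero_coeff_span[OF es] by (simp only:)
    qed
  next
    case (add f g)
    have "cls (f + g) = cls f \<ominus>\<^bsub>R\<^esub> (cls 0 \<ominus>\<^bsub>R\<^esub> cls g)" by (simp add: cls_minus)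
    then show ?case
      using coeff_span_diff[OF es] add zero_coeff_span[OF es] R_hom(4) by simp
  qed
  then show ?thesis using noetherian_if_finitely_spanned[OF es] R_carrier by auto
qed

text \<open>Regularity of \<open>x1\<close> alone does not make a quotient torsion-free over \<open>K[x1]\<close>, since another
polynomial in \<open>x1\<close> may be a zero divisor; the assumption excludes this.\<close>

lemma cohen_macaulay_iff_x1_regular:
  assumes torsion_free: "\<And>p f. \<lbrakk>\<forall>f. Var 1 * f \<in> J \<longrightarrow> f \<in> J; p \<noteq> 0; poly_in_x1 p * f \<in> J\<rbrakk> \<Longrightarrow> f \<in> J"
  shows "cohen_macaulay R \<longleftrightarrow> (\<forall>f. Var 1 * f \<in> J \<longrightarrow> f \<in> J)"
proof
  assume "cohen_macaulay R"
  then have "nonzerodivisor R (cls (Var 1))"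
    by (rule cohen_macaulay_imp_nonzerodivisor) (auto simp: axis_map_cls axis_restriction_Var_1)
  then show "\<forall>f. Var 1 * f \<in> J \<longrightarrow> f \<in> J" by (simp add: cls_nonzerodivisor_iff)
next
  assume x1: "\<forall>f. Var 1 * f \<in> J \<longrightarrow> f \<in> J"
  show "cohen_macaulay R"
  proof (rule cohen_macaulay_if_torsion_free[OF noetherian])
    fix p :: "'k poly" assume "p \<noteq> 0"
    then have "nonzerodivisor R (cls (poly_in_x1 p))"
      using torsion_free[OF x1] by (auto simp: cls_nonzerodivisor_iff)
    then show "\<exists>a\<in>carrier R. axis_map a = p \<and> nonzerodivisor R a"
      using axis_map_cls[of "poly_in_x1 p"] axis_restriction_poly_in_x1[of p] cls_carrier by metis
  qed
qed

end


section \<open>The curve ideal and its ideal of initial forms\<close>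

lemma param_hom_lin_ext:
  "param_hom n = (lin_ext (\<lambda>u. Polynomial.monom 1 (wt n u)) :: 'k::field poly4 \<Rightarrow> 'k poly)"
proof -
  have "(\<Prod>i\<in>A. (Polynomial.monom 1 (n i)) ^ ev u i) =
      (Polynomial.monom 1 (\<Sum>i\<in>A. ev u i * n i) :: 'k poly)"
    if "finite A" for A u
    using that by induction (auto simp: monom_power Polynomial.mult_monom monom_0 one_pCons mult.commute)
  then show ?thesis by (auto simp: param_hom_def lin_ext_def wt_def fun_eq_iff)
qed

lemma binomial_in_curve_ideal_iff:
  "monom4 u - monom4 v \<in> (curve_ideal n :: 'k::field poly4 set) \<longleftrightarrow> wt n u = wt n v"
  by (simp add: curve_ideal_def param_hom_lin_ext monom4_def monom_eq_iff')

definition top_degree :: "(4 \<Rightarrow> nat) \<Rightarrow> (4 \<Rightarrow>\<^sub>0 nat) \<Rightarrow> bool" where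
  "top_degree n u \<longleftrightarrow> (\<forall>v. wt n v = wt n u \<longrightarrow> mdeg v \<le> mdeg u)"

text \<open>The kernel of this map will turn out to be the ideal of initial forms: a monomial that does not
have top degree is the initial form of a binomial of the curve ideal, while two monomials of top degree and
equal weight also have equal degree, so that their difference is its own initial form.\<close>

definition top_part :: "(4 \<Rightarrow> nat) \<Rightarrow> 'k::field poly4 \<Rightarrow> 'k poly" where
  "top_part n = lin_ext (\<lambda>u. if top_degree n u then Polynomial.monom 1 (wt n u) else 0)"

lemma coeff_top_part:
  "Polynomial.coeff (top_part n f) k =
    (\<Sum>u\<in>Poly_Mapping.keys f. if top_degree n u \<and> wt n u = k then Poly_Mapping.lookup f u else 0)"
  unfolding top_part_def coeff_lin_ext by (rule sum.cong) auto

lemma top_degree_add_imp: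
  assumes "top_degree n (v + u)"
  shows "top_degree n u"
  unfolding top_degree_def
proof (intro allI impI)
  fix w assume "wt n w = wt n u"
  then have "wt n (v + w) = wt n (v + u)" by simp
  then have "mdeg (v + w) \<le> mdeg (v + u)"
    using assms unfolding top_degree_def by blast
  then show "mdeg w \<le> mdeg u" by simp
qed

lemma top_degree_same_weight:
  assumes "top_degree n u" "wt n v = wt n u"
  shows "top_degree n v \<longleftrightarrow> mdeg v = mdeg u"
  using assms unfolding top_degree_def by (metis le_antisym)

lemma mdeg_le_wt:
  assumes pos: "\<forall>i. 0 < n i"
  shows "mdeg u \<le> wt n u"
  unfolding mdeg_def wt_def
proof (rule sum_mono)
  fix i :: 4
  have "1 \<le> n i" using pos by (simp add: Suc_le_eq)
  then show "ev u i \<le> ev u i * n i" by simp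
qed

lemma ex_top_degree:
  assumes pos: "\<forall>i. 0 < n i"
  obtains r where "wt n r = wt n u" "top_degree n r"
proof -
  have "\<exists>r. wt n r = wt n u \<and> (\<forall>v. wt n v = wt n u \<longrightarrow> mdeg v \<le> mdeg r)"
    using mdeg_le_wt[OF pos]
    by (intro Lattices_Big.ex_has_greatest_nat[of "\<lambda>v. wt n v = wt n u" u mdeg "Suc (wt n u)"])
      (simp, metis less_Suc_eq_le less_imp_le)
  then show thesis using that unfolding top_degree_def by metis
qed

text \<open>Multiplication by a monomial shifts the coefficients of \<open>top_part\<close> and may erase some of them: for
each weight, either all monomials of top degree still have top degree after multiplication, or none
of them has.\<close>

lemma top_part_kernel_ideal: "ideal {f. top_part n f = (0 :: 'k::field poly)} poly4_ring"
proof (rule type_ring_idealI)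
  fix f r :: "'k poly4"
  assume "f \<in> {f. top_part n f = 0}"
  then have f: "top_part n f = 0" by simp
  have "top_part n (Poly_Mapping.single v 1 * f) = 0" for v
  proof (rule poly_eqI)
    fix k
    let ?g = "\<lambda>u. if top_degree n (v + u) \<and> wt n (v + u) = k then Poly_Mapping.lookup f u else 0"
    have "Polynomial.coeff (top_part n (Poly_Mapping.single v 1 * f)) k
        = (\<Sum>u\<in>Poly_Mapping.keys f. ?g u)"
      unfolding top_part_def lin_ext_mult_single Polynomial.smult_1_left coeff_lin_ext
      by (rule sum.cong) auto
    also have "\<dots> = 0"
    proof (cases "\<exists>u0. top_degree n (v + u0) \<and> wt n (v + u0) = k")
      case True
      then obtain u0 where u0: "top_degree n (v + u0)" "wt n (v + u0) = k" by blast
      \<comment> \<open>within one weight, \<open>v + u\<close> has top degree exactly if \<open>u\<close> has\<close>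
      have "top_degree n (v + u) \<and> wt n (v + u) = k \<longleftrightarrow> top_degree n u \<and> wt n u = wt n u0" for u
        using u0 top_degree_same_weight[OF u0(1), of "v + u"]
          top_degree_same_weight[OF top_degree_add_imp[OF u0(1)], of u] by auto
      then have "(\<Sum>u\<in>Poly_Mapping.keys f. ?g u) = Polynomial.coeff (top_part n f) (wt n u0)"
        by (simp add: coeff_top_part)
      then show ?thesis using f by simp
    next
      case False
      then show ?thesis by (intro sum.neutral) auto
    qed
    finally show "Polynomial.coeff (top_part n (Poly_Mapping.single v 1 * f)) k = Polynomial.coeff 0 k"
      by simp
  qed
  then have mono: "top_part n (Poly_Mapping.single v c * f) = 0" for v c
    by (simp add: top_part_def lin_ext_mult_single)
  have "top_part n (r * f) = 0"
  proof (induction r rule: poly_mapping_induct_single)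
    case (single v c)
    show ?case by (rule mono)
  next
    case (add r s)
    then show ?case by (simp add: top_part_def distrib_right)
  qed
  then show "r * f \<in> {f. top_part n f = 0}" by simp
qed (auto simp: top_part_def)

lemma lookup_initial_form:
  "Poly_Mapping.lookup (initial_form f) u =
    (if \<forall>v\<in>Poly_Mapping.keys f. mdeg u \<le> mdeg v then Poly_Mapping.lookup f u else 0)"
proof -
  have "Poly_Mapping.lookup (initial_form f) u =
     (\<Sum>x | x \<in> Poly_Mapping.keys f \<and> (\<forall>v\<in>Poly_Mapping.keys f. mdeg x \<le> mdeg v).
       if x = u then Poly_Mapping.lookup f x else 0)"
    unfolding initial_form_def lookup_sum by (rule sum.cong) (auto simp: lookup_single when_def)
  also have "\<dots> = (if \<forall>v\<in>Poly_Mapping.keys f. mdeg u \<le> mdeg v then Poly_Mapping.lookup f u else 0)"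
    by (subst sum.delta) (auto simp: in_keys_iff)
  finally show ?thesis .
qed

lemma keys_initial_form:
  "Poly_Mapping.keys (initial_form f) =
    {u \<in> Poly_Mapping.keys f. \<forall>v\<in>Poly_Mapping.keys f. mdeg u \<le> mdeg v}"
  by (auto simp: in_keys_iff lookup_initial_form split: if_splits)

lemma keys_binomial:
  "u \<noteq> v \<Longrightarrow> Poly_Mapping.keys (monom4 u - monom4 v :: 'k::field poly4) = {u, v}"
  by (auto simp: monom4_def in_keys_iff lookup_minus lookup_single when_def split: if_splits)

lemma top_part_initial_form:
  assumes f: "f \<in> curve_ideal n"
  shows "top_part n (initial_form f) = 0"
proof (rule poly_eqI)
  fix k
  let ?K = "Poly_Mapping.keys f" and ?I = "Poly_Mapping.keys (initial_form f)"
  have "(\<Sum>u\<in>?I. if top_degree n u \<and> wt n u = k then Poly_Mapping.lookup (initial_form f) u else 0) = 0"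
  proof (cases "\<exists>u0\<in>?I. top_degree n u0 \<and> wt n u0 = k")
    case True
    then obtain u0 where u0: "u0 \<in> ?I" "top_degree n u0" "wt n u0 = k" by blast
    \<comment> \<open>a term of least degree that has top degree forces all terms of its weight into that degree\<close>
    have in_I: "u \<in> ?I \<and> top_degree n u" if "u \<in> ?K" "wt n u = k" for u
    proof -
      have "mdeg u = mdeg u0"
        using u0 that unfolding keys_initial_form top_degree_def by (auto intro: le_antisym)
      then show ?thesis
        using u0 that top_degree_same_weight[OF u0(2), of u] unfolding keys_initial_form by auto
    qed
    have "(\<Sum>u\<in>?I. if top_degree n u \<and> wt n u = k then Poly_Mapping.lookup (initial_form f) u else 0)
      = (\<Sum>u\<in>?K. if wt n u = k then Poly_Mapping.lookup f u else 0)"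
      using in_I
      by (intro sum.mono_neutral_cong_left) (auto simp: keys_initial_form lookup_initial_form)
    also have "\<dots> = Polynomial.coeff (param_hom n f) k"
      unfolding param_hom_lin_ext coeff_lin_ext by (rule sum.cong) auto
    also have "\<dots> = 0" using f by (simp add: curve_ideal_def)
    finally show ?thesis .
  next
    case False
    then show ?thesis by (intro sum.neutral) auto
  qed
  then show "Polynomial.coeff (top_part n (initial_form f)) k = Polynomial.coeff 0 k"
    by (simp add: coeff_top_part)
qed

lemma initial_form_homogeneous:
  assumes "\<And>u v. u \<in> Poly_Mapping.keys f \<Longrightarrow> v \<in> Poly_Mapping.keys f \<Longrightarrow> mdeg u = mdeg v"
  shows "initial_form f = f"
proof (rule poly_mapping_eqI)
  fix u
  show "Poly_Mapping.lookup (initial_form f) u = Poly_Mapping.lookup f u"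
  proof (cases "u \<in> Poly_Mapping.keys f")
    case True
    then have "\<forall>v\<in>Poly_Mapping.keys f. mdeg u \<le> mdeg v" using assms by (metis order_refl)
    then show ?thesis by (simp add: lookup_initial_form)
  next
    case False
    then show ?thesis by (simp add: lookup_initial_form in_keys_iff)
  qed
qed

text \<open>Modulo initial forms, each monomial is congruent to a normal form that depends only on its weight: \<open>0\<close>,
or a fixed monomial of top degree. In the sum of the normal forms of \<open>f\<close> the coefficients are
those of \<open>top_part n f\<close>.\<close>

lemma initial_ideal_curve_ideal:
  assumes pos: "\<forall>i. 0 < n i"
  shows "initial_ideal (curve_ideal n) = {f :: 'k::field poly4. top_part n f = 0}"
    (is "?J = ?T")
proof
  interpret P: cring "poly4_ring :: 'k poly4 ring" by (rule cring_from_type_algebra)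
  show "?J \<subseteq> ?T"
    unfolding initial_ideal_def
    by (rule P.genideal_minimal[OF top_part_kernel_ideal]) (auto simp: top_part_initial_form)
  have J: "ideal ?J poly4_ring"
    unfolding initial_ideal_def by (rule P.genideal_ideal) simp
  have in_J: "initial_form f \<in> ?J" if "f \<in> curve_ideal n" for f :: "'k poly4"
    unfolding initial_ideal_def using P.genideal_self[of "initial_form ` curve_ideal n"] that by auto
  have "\<exists>r. \<forall>u. wt n (r (wt n u)) = wt n u \<and> top_degree n (r (wt n u))"
  proof -
    have "\<forall>k. \<exists>s. \<forall>u. wt n u = k \<longrightarrow> wt n s = k \<and> top_degree n s"
      using ex_top_degree[OF pos] by metis
    then show ?thesis by metis
  qed
  then obtain r where r: "\<And>u. wt n (r (wt n u)) = wt n u" "\<And>u. top_degree n (r (wt n u))" by blast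
  define nf :: "(4 \<Rightarrow>\<^sub>0 nat) \<Rightarrow> 'k poly4" where
    "nf u = (if top_degree n u then monom4 (r (wt n u)) else 0)" for u
  have reduce: "monom4 u - nf u \<in> ?J" for u
  proof (cases "top_degree n u")
    case True
    then have "mdeg (r (wt n u)) = mdeg u"
      using r top_degree_same_weight[OF True] by metis
    then have "initial_form (monom4 u - monom4 (r (wt n u)) :: 'k poly4) = monom4 u - monom4 (r (wt n u))"
      by (intro initial_form_homogeneous)
        (auto simp: monom4_def in_keys_iff lookup_minus lookup_single when_def split: if_splits)
    moreover have "monom4 u - monom4 (r (wt n u)) \<in> (curve_ideal n :: 'k poly4 set)"
      using r by (simp add: binomial_in_curve_ideal_iff)
    ultimately show ?thesis using in_J True unfolding nf_def by metis
  next
    case False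
    then obtain v where v: "wt n v = wt n u" "mdeg u < mdeg v"
      unfolding top_degree_def by (auto simp: not_le)
    then have "u \<noteq> v" by auto
    have "initial_form (monom4 u - monom4 v :: 'k poly4) = monom4 u"
      using v(2) \<open>u \<noteq> v\<close>
      by (intro poly_mapping_eqI)
        (auto simp: lookup_initial_form keys_binomial[unfolded monom4_def] monom4_def lookup_minus lookup_single when_def)
    moreover have "monom4 u - monom4 v \<in> (curve_ideal n :: 'k poly4 set)"
      using v by (simp add: binomial_in_curve_ideal_iff)
    ultimately have "monom4 u \<in> ?J" using in_J by metis
    then show ?thesis using False by (simp add: nf_def)
  qed
  show "?T \<subseteq> ?J"
  proof
    fix f :: "'k poly4" assume "f \<in> ?T"
    then have f: "top_part n f = 0" by simp
    let ?c = "\<lambda>u. Poly_Mapping.single 0 (Poly_Mapping.lookup f u) :: 'k poly4"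
    have "(\<Sum>u\<in>Poly_Mapping.keys f. ?c u * nf u) = 0"
    proof (rule poly_mapping_eqI)
      fix v
      have "Poly_Mapping.lookup (\<Sum>u\<in>Poly_Mapping.keys f. ?c u * nf u) v =
        (\<Sum>u\<in>Poly_Mapping.keys f. if top_degree n u \<and> r (wt n u) = v then Poly_Mapping.lookup f u else 0)"
        unfolding lookup_sum
        by (rule sum.cong) (auto simp: nf_def monom4_def mult_single lookup_single when_def)
      also have "\<dots> = (if r (wt n v) = v then Polynomial.coeff (top_part n f) (wt n v) else 0)"
      proof (cases "r (wt n v) = v")
        case True
        then have "r (wt n u) = v \<longleftrightarrow> wt n u = wt n v" for u using r(1) by metis
        then show ?thesis using True by (simp add: coeff_top_part)
      next
        case False
        then have "r (wt n u) \<noteq> v" for u using r(1) by metis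
        then show ?thesis using False by simp
      qed
      finally show "Poly_Mapping.lookup (\<Sum>u\<in>Poly_Mapping.keys f. ?c u * nf u) v = Poly_Mapping.lookup 0 v"
        using f by simp
    qed
    moreover have "f = (\<Sum>u\<in>Poly_Mapping.keys f. ?c u * monom4 u)"
      by (subst poly_mapping_as_sum) (simp add: monom4_def mult_single)
    ultimately have "f = (\<Sum>u\<in>Poly_Mapping.keys f. ?c u * (monom4 u - nf u))"
      by (simp add: right_diff_distrib sum_subtractf)
    also have "\<dots> \<in> ?J" by (intro type_ideal_sum[OF J] type_ideal_mult[OF J] reduce)
    finally show "f \<in> ?J" .
  qed
qed


section \<open>Cohen--Macaulayness of the tangent cone in terms of weights and degrees\<close>

lemma wt_single [simp]: "wt n (Poly_Mapping.single i k) = k * n i"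
proof -
  have "wt n (Poly_Mapping.single i k) = (\<Sum>j\<in>UNIV. if i = j then k * n j else 0)"
    unfolding wt_def by (rule sum.cong) auto
  then show ?thesis by simp
qed

lemma mdeg_single [simp]: "mdeg (Poly_Mapping.single i k) = k"
  by (simp add: mdeg_def)

lemma split_off_x1:
  assumes "0 < ev u 1"
  obtains v where "u = Poly_Mapping.single 1 1 + v"
proof
  show "u = Poly_Mapping.single 1 1 + (u - Poly_Mapping.single 1 1)"
    using assms by (intro poly_mapping_eqI) (auto simp: lookup_add lookup_minus)
qed

lemma lin_ext_scale: "lin_ext (\<lambda>u. q * g u) f = q * lin_ext g f"
  by (simp add: lin_ext_def sum_distrib_left mult_smult_right)

locale least_first_weight =
  fixes n :: "4 \<Rightarrow> nat"
  assumes pos: "\<forall>i. 0 < n i" and least: "i \<noteq> 1 \<Longrightarrow> n 1 < n i"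
begin

text \<open>Replacing any variable by \<open>x1\<close> lowers the weight, so a power of \<open>x1\<close> is the only monomial of its
weight with at least its degree.\<close>

lemma wt_x1_power_unique:
  assumes "wt n v = a * n 1" "a \<le> mdeg v"
  shows "v = Poly_Mapping.single 1 a"
proof -
  have lt: "n 1 < n 2" "n 1 < n 3" "n 1 < n 4" using least by auto
  have le: "ev v i * Suc (n 1) \<le> ev v i * n i" if "i \<noteq> 1" for i
    using least[OF that] by (intro mult_le_mono2) simp
  have "mdeg v * n 1 + (ev v 2 + ev v 3 + ev v 4) \<le> wt n v"
    using le[of 2] le[of 3] le[of 4] by (simp add: mdeg_ev wt_ev algebra_simps)
  moreover have "a * n 1 \<le> mdeg v * n 1" using assms(2) by simp
  ultimately have z: "ev v 2 = 0" "ev v 3 = 0" "ev v 4 = 0" using assms(1) by linarith+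
  then have "ev v 1 = a" using assms(1) pos[rule_format, of 1] by (simp add: wt_ev)
  with z show ?thesis by (intro expo_eqI) auto
qed

lemma top_degree_x1_power: "top_degree n (Poly_Mapping.single 1 a)"
  unfolding top_degree_def
proof (intro allI impI)
  fix v assume v: "wt n v = wt n (Poly_Mapping.single 1 a)"
  show "mdeg v \<le> mdeg (Poly_Mapping.single 1 a)"
    using wt_x1_power_unique[of v a] v by (cases "a \<le> mdeg v") auto
qed

lemma top_part_kernel_axis_thickening:
  "axis_thickening {f :: 'k::field poly4. top_part n f = 0} (n 1)"
proof (rule axis_thickening.intro)
  show "ideal {f :: 'k poly4. top_part n f = 0} poly4_ring" by (rule top_part_kernel_ideal)
next
  fix f :: "'k poly4" assume "f \<in> {f. top_part n f = 0}"
  then have f: "top_part n f = 0" by simp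
  show "axis_restriction f = 0"
  proof (rule poly_eqI)
    fix a
    let ?u = "Poly_Mapping.single 1 a :: 4 \<Rightarrow>\<^sub>0 nat"
    have uniq: "top_degree n v \<and> wt n v = a * n 1 \<longleftrightarrow> v = ?u" for v
      using top_degree_x1_power[of a] top_degree_same_weight[of n ?u v] wt_x1_power_unique[of v a]
      by auto
    have "Polynomial.coeff (axis_restriction f) (ev ?u 1) = Poly_Mapping.lookup f ?u"
      by (rule axis_restriction_coeff) auto
    also have "\<dots> = Polynomial.coeff (top_part n f) (a * n 1)"
      unfolding coeff_top_part uniq by (simp add: in_keys_iff)
    finally show "Polynomial.coeff (axis_restriction f) a = Polynomial.coeff 0 a" using f by simp
  qed
next
  fix i :: 4 assume i: "i \<noteq> 1"
  have "\<not> top_degree n (Poly_Mapping.single i (n 1))"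
    unfolding top_degree_def not_all not_imp
    using least[OF i] by (intro exI[of _ "Poly_Mapping.single 1 (n i)"]) (simp add: mult.commute)
  then have "top_part n (Var i ^ n 1) = 0"
    by (simp add: Var_power top_part_def monom4_def)
  then show "Var i ^ n 1 \<in> {f :: 'k poly4. top_part n f = 0}" by simp
qed

lemma top_degree_x1_iff:
  assumes "\<forall>u. top_degree n u \<longrightarrow> top_degree n (Poly_Mapping.single 1 1 + u)"
  shows "top_degree n (Poly_Mapping.single 1 1 + u) \<longleftrightarrow> top_degree n u"
  using assms top_degree_add_imp by blast

text \<open>The source becomes a module over \<open>K[x1]\<close>, and \<open>top_part\<close> is linear over it when \<open>x1\<close> acts on
\<open>K[t]\<close> as multiplication by \<open>t ^ n 1\<close>.\<close>

lemma top_part_mult_poly_in_x1: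
  fixes f :: "'k::field poly4"
  assumes "\<forall>u. top_degree n u \<longrightarrow> top_degree n (Poly_Mapping.single 1 1 + u)"
  shows "top_part n (poly_in_x1 p * f) = pcompose p (Polynomial.monom 1 (n 1)) * top_part n f"
proof (induction p)
  case 0
  then show ?case by (simp add: top_part_def)
next
  case (pCons c p)
  let ?q = "Polynomial.monom 1 (n 1) :: 'k poly"
  have x1: "top_part n (Var 1 * g) = ?q * top_part n g" for g :: "'k poly4"
  proof -
    have "top_part n (Var 1 * g)
        = lin_ext (\<lambda>u. ?q * (if top_degree n u then Polynomial.monom 1 (wt n u) else 0)) g"
      unfolding top_part_def Var_def monom4_def lin_ext_mult_single Polynomial.smult_1_left
      by (rule lin_ext_cong)
        (use top_degree_x1_iff[OF assms] in \<open>auto simp: Polynomial.mult_monom\<close>)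
    then show ?thesis by (simp add: lin_ext_scale top_part_def)
  qed
  have const: "top_part n (Poly_Mapping.single 0 c * f) = Polynomial.smult c (top_part n f)"
    unfolding top_part_def lin_ext_mult_single add_0_left ..
  have "poly_in_x1 (pCons c p) * f = Poly_Mapping.single 0 c * f + Var 1 * (poly_in_x1 p * f)"
    by (simp add: poly_in_x1_pCons algebra_simps)
  then have "top_part n (poly_in_x1 (pCons c p) * f)
      = top_part n (Poly_Mapping.single 0 c * f) + top_part n (Var 1 * (poly_in_x1 p * f))"
    by (simp add: top_part_def)
  then show ?case using pCons.IH
    by (simp only: x1 const) (simp add: pcompose_pCons algebra_simps)
qed

lemma cm_tangent_cone_iff_top_degree:
  "cm_tangent_cone (curve_ideal n :: 'k::field poly4 set) \<longleftrightarrow>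
    (\<forall>u. top_degree n u \<longrightarrow> top_degree n (Poly_Mapping.single 1 1 + u))"
proof -
  let ?J = "{f :: 'k poly4. top_part n f = 0}"
  let ?H = "\<forall>u. top_degree n u \<longrightarrow> top_degree n (Poly_Mapping.single 1 1 + u)"
  interpret axis_thickening ?J "n 1" by (rule top_part_kernel_axis_thickening)
  have imp: ?H if regular: "\<forall>f. Var 1 * f \<in> ?J \<longrightarrow> f \<in> ?J"
  proof (rule ccontr)
    assume "\<not> ?H"
    then obtain u where u: "top_degree n u" "\<not> top_degree n (Poly_Mapping.single 1 1 + u)" by blast
    then have "Var 1 * monom4 u \<in> ?J"
      by (simp add: Var_def monom4_mult) (simp add: monom4_def top_part_def)
    with regular have "top_part n (monom4 u :: 'k poly4) = 0" by blast
    with u(1) show False by (simp add: monom4_def top_part_def)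
  qed
  have no_torsion: "f \<in> ?J" if "?H" "p \<noteq> 0" "poly_in_x1 p * f \<in> ?J" for p f
  proof -
    have "Polynomial.degree (Polynomial.monom 1 (n 1) :: 'k poly) > 0"
      using pos by (simp add: Polynomial.degree_monom_eq)
    then have "pcompose p (Polynomial.monom 1 (n 1)) \<noteq> 0"
      using pcompose_eq_0[of p "Polynomial.monom 1 (n 1)"] that(2) by blast
    then show ?thesis using that top_part_mult_poly_in_x1[OF that(1), of p f] by auto
  qed
  have "cohen_macaulay (poly4_ring Quot ?J) \<longleftrightarrow> (\<forall>f. Var 1 * f \<in> ?J \<longrightarrow> f \<in> ?J)"
    using no_torsion imp by (intro cohen_macaulay_iff_x1_regular) blast
  also have "\<dots> \<longleftrightarrow> ?H"
    using imp no_torsion[of "[:0, 1:]"] by (auto simp: poly_in_x1_X)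
  finally show ?thesis
    unfolding cm_tangent_cone_def initial_ideal_curve_ideal[OF pos] .
qed

text \<open>Applied to a monomial of top degree in a weight \<open>n 1 + w\<close>, the right-hand side says that the maximal
degree in this weight is one more than the maximal degree in the weight \<open>w\<close>.\<close>

lemma cm_tangent_cone_iff:
  "cm_tangent_cone (curve_ideal n :: 'k::field poly4 set) \<longleftrightarrow>
    (\<forall>M v. wt n v = wt n M \<and> 0 < ev v 1 \<longrightarrow> (\<exists>N. 0 < ev N 1 \<and> wt n N = wt n M \<and> mdeg M \<le> mdeg N))"
  unfolding cm_tangent_cone_iff_top_degree
proof (intro iffI allI impI)
  fix M v
  assume H: "\<forall>u. top_degree n u \<longrightarrow> top_degree n (Poly_Mapping.single 1 1 + u)"
    and v: "wt n v = wt n M \<and> 0 < ev v 1"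
  then obtain w where w: "v = Poly_Mapping.single 1 1 + w" using split_off_x1 by blast
  obtain r where r: "wt n r = wt n w" "top_degree n r" using ex_top_degree[OF pos] by blast
  then have top: "top_degree n (Poly_Mapping.single 1 1 + r)" using H by blast
  show "\<exists>N. 0 < ev N 1 \<and> wt n N = wt n M \<and> mdeg M \<le> mdeg N"
  proof (intro exI conjI)
    show wt: "wt n (Poly_Mapping.single 1 1 + r) = wt n M" using v w r by simp
    show "mdeg M \<le> mdeg (Poly_Mapping.single 1 1 + r)"
      using top wt unfolding top_degree_def by metis
  qed (simp add: lookup_add)
next
  fix u
  assume star: "\<forall>M v. wt n v = wt n M \<and> 0 < ev v 1 \<longrightarrow>
      (\<exists>N. 0 < ev N 1 \<and> wt n N = wt n M \<and> mdeg M \<le> mdeg N)"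
    and u: "top_degree n u"
  show "top_degree n (Poly_Mapping.single 1 1 + u)"
    unfolding top_degree_def
  proof (intro allI impI)
    fix M assume M: "wt n M = wt n (Poly_Mapping.single 1 1 + u)"
    then obtain N where N: "0 < ev N 1" "wt n N = wt n M" "mdeg M \<le> mdeg N"
      using star[rule_format, of "Poly_Mapping.single 1 1 + u" M] by (auto simp: lookup_add)
    obtain w where w: "N = Poly_Mapping.single 1 1 + w" using split_off_x1 N by blast
    then have "mdeg w \<le> mdeg u" using u N M unfolding top_degree_def by simp
    then show "mdeg M \<le> mdeg (Poly_Mapping.single 1 1 + u)" using N w by simp
  qed
qed

end


section \<open>Fibres of the weight map\<close>

text \<open>If a set \<open>C\<close> of monomials is closed under the exchanges given by binomial generators, then the sum
of the coefficients over \<open>C\<close>, and over all translates of \<open>C\<close>, vanishes on the ideal; hence a binomial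
of the ideal cannot have exactly one of its terms in \<open>C\<close>.\<close>

lemma fibre_in_closed_class:
  fixes G :: "'k::field poly4 set"
  assumes gen: "genideal poly4_ring G = curve_ideal n"
    and closed: "\<And>g. g \<in> G \<Longrightarrow> \<exists>p q. g = monom4 p - monom4 q \<and> (\<forall>w. w + p \<in> C \<longleftrightarrow> w + q \<in> C)"
    and u: "u \<in> C" and v: "wt n v = wt n u"
  shows "v \<in> C"
proof -
  interpret P: cring "poly4_ring :: 'k poly4 ring" by (rule cring_from_type_algebra)
  define L :: "'k poly4 \<Rightarrow> 'k poly" where "L = lin_ext (\<lambda>u. if u \<in> C then 1 else 0)"
  define T where "T = {f. \<forall>w. L (Poly_Mapping.single w 1 * f) = 0}"
  have "ideal T poly4_ring"
  proof (rule type_ring_idealI)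
    show "0 \<in> T" by (simp add: T_def L_def)
  next
    fix f g assume "f \<in> T" "g \<in> T"
    then show "f + g \<in> T" by (simp add: T_def L_def distrib_left)
  next
    fix r f assume f: "f \<in> T"
    show "r * f \<in> T"
    proof (induction r rule: poly_mapping_induct_single)
      case (single v c)
      have "L (Poly_Mapping.single w 1 * (Poly_Mapping.single v c * f))
          = Polynomial.smult c (L (Poly_Mapping.single (w + v) 1 * f))" for w
        by (simp add: L_def lin_ext_mult_single mult_single add.assoc flip: mult.assoc)
      then show ?case using f by (simp add: T_def)
    next
      case (add r s)
      then show ?case by (simp add: T_def L_def distrib_left distrib_right)
    qed
  qed
  moreover have "G \<subseteq> T"
  proof
    fix g assume "g \<in> G"
    then obtain p q where "g = monom4 p - monom4 q" "\<And>w. w + p \<in> C \<longleftrightarrow> w + q \<in> C"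
      using closed by blast
    then show "g \<in> T" by (simp add: T_def L_def right_diff_distrib monom4_def mult_single)
  qed
  ultimately have "curve_ideal n \<subseteq> T" using gen P.genideal_minimal by blast
  then have "monom4 u - monom4 v \<in> T" using v by (auto simp: binomial_in_curve_ideal_iff)
  then have "L (Poly_Mapping.single 0 1 * (monom4 u - monom4 v)) = 0" unfolding T_def by blast
  then have "L (monom4 u - monom4 v) = 0" by simp
  then show "v \<in> C" using u by (simp add: L_def monom4_def split: if_splits)
qed

lemma num_semigroup_wt: "m \<in> num_semigroup n \<longleftrightarrow> (\<exists>u. m = wt n u)"
proof
  assume "m \<in> num_semigroup n"
  then obtain g :: "4 \<Rightarrow> nat" where "m = (\<Sum>i\<in>UNIV. g i * n i)" unfolding num_semigroup_def by blast
  then show "\<exists>u. m = wt n u"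
    by (intro exI[of _ "expo (g 1) (g 2) (g 3) (g 4)"]) (simp add: wt_ev sum_4)
qed (auto simp: num_semigroup_def wt_def)

lemma x1_shifted_semigroup:
  "k \<in> {n 1 + m | m. m \<in> num_semigroup n} \<longleftrightarrow> (\<exists>v. wt n v = k \<and> 0 < ev v 1)"
proof
  assume "k \<in> {n 1 + m | m. m \<in> num_semigroup n}"
  then obtain u where "k = n 1 + wt n u" by (auto simp: num_semigroup_wt)
  then show "\<exists>v. wt n v = k \<and> 0 < ev v 1"
    by (intro exI[of _ "Poly_Mapping.single 1 1 + u"]) (simp add: lookup_add)
next
  assume "\<exists>v. wt n v = k \<and> 0 < ev v 1"
  then obtain v where v: "wt n v = k" "0 < ev v 1" by blast
  then obtain w where "v = Poly_Mapping.single 1 1 + w" using split_off_x1 by blast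
  with v show "k \<in> {n 1 + m | m. m \<in> num_semigroup n}" by (auto simp: num_semigroup_wt)
qed


section \<open>Exchanging terms of the five generators\<close>

text \<open>The numerical parameters do not determine the coefficient field; \<open>field_type\<close> does.\<close>

locale five_binomial_curve =
  fixes n :: "4 \<Rightarrow> nat" and a1 a2 a3 a4 a13 a14 a21 a23 a32 a34 a41 a42 :: nat
    and field_type :: "'k::field itself"
  assumes pos: "\<forall>i. 0 < n i"
    and incr: "n 1 < n 2" "n 2 < n 3" "n 3 < n 4"
    and exponents:
      "0 < a21" "a21 < a1" "0 < a41" "a41 < a1" "0 < a32" "a32 < a2" "0 < a42" "a42 < a2"
      "0 < a13" "a13 < a3" "0 < a23" "a23 < a3" "0 < a14" "a14 < a4" "0 < a34" "a34 < a4"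
    and gens: "genideal poly4_ring
      {Var 1 ^ a1 - Var 3 ^ a13 * Var 4 ^ a14,
       Var 2 ^ a2 - Var 1 ^ a21 * Var 3 ^ a23,
       Var 3 ^ a3 - Var 2 ^ a32 * Var 4 ^ a34,
       Var 4 ^ a4 - Var 1 ^ a41 * Var 2 ^ a42,
       Var 1 ^ a21 * Var 4 ^ a34 - Var 2 ^ a42 * Var 3 ^ a13} = (curve_ideal n :: 'k poly4 set)"
begin

definition generators :: "'k poly4 set" where
  "generators =
    {monom4 (expo a1 0 0 0) - monom4 (expo 0 0 a13 a14),
     monom4 (expo 0 a2 0 0) - monom4 (expo a21 0 a23 0),
     monom4 (expo 0 0 a3 0) - monom4 (expo 0 a32 0 a34),
     monom4 (expo 0 0 0 a4) - monom4 (expo a41 a42 0 0),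
     monom4 (expo a21 0 0 a34) - monom4 (expo 0 a42 a13 0)}"

lemma generate: "genideal poly4_ring generators = (curve_ideal n :: 'k poly4 set)"
  using gens by (simp add: generators_def Var_power monom4_mult expo_def)

lemma generators_in: "g \<in> generators \<Longrightarrow> g \<in> curve_ideal n"
proof -
  interpret P: cring "poly4_ring :: 'k poly4 ring" by (rule cring_from_type_algebra)
  show "g \<in> generators \<Longrightarrow> g \<in> curve_ideal n"
    using P.genideal_self[of generators] generate by auto
qed

lemma weights:
  "a1 * n 1 = a13 * n 3 + a14 * n 4" "a2 * n 2 = a21 * n 1 + a23 * n 3"
  "a3 * n 3 = a32 * n 2 + a34 * n 4" "a4 * n 4 = a41 * n 1 + a42 * n 2"
  "a21 * n 1 + a34 * n 4 = a42 * n 2 + a13 * n 3"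
proof -
  have "\<forall>g\<in>generators. g \<in> curve_ideal n" using generators_in by blast
  then show
    "a1 * n 1 = a13 * n 3 + a14 * n 4" "a2 * n 2 = a21 * n 1 + a23 * n 3"
    "a3 * n 3 = a32 * n 2 + a34 * n 4" "a4 * n 4 = a41 * n 1 + a42 * n 2"
    "a21 * n 1 + a34 * n 4 = a42 * n 2 + a13 * n 3"
    by (simp_all add: generators_def binomial_in_curve_ideal_iff wt_ev)
qed

text \<open>The closure condition of \<open>fibre_in_closed_class\<close>, spelled out for \<open>f1, \<dots>, f5\<close> in coordinates.\<close>

lemma fibre_in_closed_predicate:
  assumes "\<And>a b c d. P (a + a1) b c d \<longleftrightarrow> P a b (c + a13) (d + a14)"
    and "\<And>a b c d. P a (b + a2) c d \<longleftrightarrow> P (a + a21) b (c + a23) d"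
    and "\<And>a b c d. P a b (c + a3) d \<longleftrightarrow> P a (b + a32) c (d + a34)"
    and "\<And>a b c d. P a b c (d + a4) \<longleftrightarrow> P (a + a41) (b + a42) c d"
    and "\<And>a b c d. P (a + a21) b c (d + a34) \<longleftrightarrow> P a (b + a42) (c + a13) d"
    and u: "P (ev u 1) (ev u 2) (ev u 3) (ev u 4)" and v: "wt n v = wt n u"
  shows "P (ev v 1) (ev v 2) (ev v 3) (ev v 4)"
proof -
  let ?C = "{u. P (ev u 1) (ev u 2) (ev u 3) (ev u 4)}"
  have "v \<in> ?C"
  proof (rule fibre_in_closed_class[OF generate _ _ v])
    fix g assume "g \<in> generators"
    then consider
        "g = monom4 (expo a1 0 0 0) - monom4 (expo 0 0 a13 a14)"
      | "g = monom4 (expo 0 a2 0 0) - monom4 (expo a21 0 a23 0)"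
      | "g = monom4 (expo 0 0 a3 0) - monom4 (expo 0 a32 0 a34)"
      | "g = monom4 (expo 0 0 0 a4) - monom4 (expo a41 a42 0 0)"
      | "g = monom4 (expo a21 0 0 a34) - monom4 (expo 0 a42 a13 0)"
      unfolding generators_def by blast
    then show "\<exists>p q. g = monom4 p - monom4 q \<and> (\<forall>w. w + p \<in> ?C \<longleftrightarrow> w + q \<in> ?C)"
      by cases (rule exI, rule exI, rule conjI, assumption, simp add: lookup_add assms)+
  qed (use u in simp)
  then show ?thesis by simp
qed

text \<open>No term of a generator divides \<open>x2 ^ k\<close> for \<open>k < a2\<close>, so nothing can be exchanged.\<close>

lemma x2_power_unique:
  assumes "k < a2" "wt n v = k * n 2"
  shows "v = expo 0 k 0 0"
  using fibre_in_closed_predicate[of "\<lambda>a b c d. a = 0 \<and> b = k \<and> c = 0 \<and> d = 0" "expo 0 k 0 0" v]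
    assms exponents
  by (intro expo_eqI) (auto simp: wt_ev)

lemma x4_power_unique:
  assumes "k < a4" "wt n v = k * n 4"
  shows "v = expo 0 0 0 k"
  using fibre_in_closed_predicate[of "\<lambda>a b c d. a = 0 \<and> b = 0 \<and> c = 0 \<and> d = k" "expo 0 0 0 k" v]
    assms exponents
  by (intro expo_eqI) (auto simp: wt_ev)

text \<open>One half of Bresinsky's relation \<open>a2 = a32 + a42\<close>. Adding the weight equations of \<open>f2\<close>, \<open>f3\<close> and \<open>f5\<close>
turns a positive difference \<open>e = a2 - a32 - a42\<close> into a second monomial, a power of \<open>x3\<close>, with the
weight of \<open>x2 ^ e\<close>.\<close>

lemma a2_le: "a2 \<le> a32 + a42"
proof (rule ccontr)
  assume "\<not> ?thesis"
  then obtain e where e: "a2 = a32 + a42 + e" "0 < e"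
    using less_imp_add_positive[of "a32 + a42" a2] by auto
  have eq: "e * n 2 + a3 * n 3 = (a13 + a23) * n 3"
    using weights(2,3,5) by (simp add: e(1) algebra_simps)
  then have "a3 * n 3 \<le> (a13 + a23) * n 3" by linarith
  then have "a3 \<le> a13 + a23" using pos by simp
  then obtain e' where "a13 + a23 = a3 + e'" using le_Suc_ex by blast
  with eq have "wt n (expo 0 0 e' 0) = e * n 2" by (simp add: wt_ev algebra_simps)
  then have "expo 0 0 e' 0 = expo 0 e 0 0" using x2_power_unique[of e] e exponents by simp
  with e(2) show False by simp
qed

text \<open>As before, now from \<open>f1\<close>, \<open>f4\<close> and \<open>f5\<close>: otherwise a small power of \<open>x4\<close> has the weight of a power
of \<open>x1\<close>.\<close>

lemma a4_le: "a4 \<le> a14 + a34"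
proof (rule ccontr)
  assume "\<not> ?thesis"
  then obtain e where e: "a4 = a14 + a34 + e" "0 < e"
    using less_imp_add_positive[of "a14 + a34" a4] by auto
  have eq: "e * n 4 + a1 * n 1 = (a21 + a41) * n 1"
    using weights(1,4,5) by (simp add: e(1) algebra_simps)
  then have "a1 * n 1 \<le> (a21 + a41) * n 1" by linarith
  then have "a1 \<le> a21 + a41" using pos by simp
  then obtain e' where "a21 + a41 = a1 + e'" using le_Suc_ex by blast
  with eq have "wt n (expo e' 0 0 0) = e * n 4" by (simp add: wt_ev algebra_simps)
  then have "expo e' 0 0 0 = expo 0 0 0 e" using x4_power_unique[of e] e exponents by simp
  with e(2) show False by simp
qed

lemma fibre_x2_power:
  assumes "wt n N = a2 * n 2" "0 < ev N 1"
  shows "N = expo a21 0 a23 0"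
  using fibre_in_closed_predicate[of "\<lambda>a b c d. (a = 0 \<and> b = a2 \<and> c = 0 \<and> d = 0)
      \<or> (a = a21 \<and> b = 0 \<and> c = a23 \<and> d = 0)" "expo 0 a2 0 0" N] assms exponents
  by (intro expo_eqI) (auto simp: wt_ev)

lemma fibre_x2_x3_product:
  assumes "wt n N = a42 * n 2 + a13 * n 3" "0 < ev N 1"
  shows "N = expo a21 0 0 a34"
  using fibre_in_closed_predicate[of "\<lambda>a b c d. (a = 0 \<and> b = a42 \<and> c = a13 \<and> d = 0)
      \<or> (a = a21 \<and> b = 0 \<and> c = 0 \<and> d = a34)" "expo 0 a42 a13 0" N] assms exponents
  by (intro expo_eqI) (auto simp: wt_ev)

lemma a1_ge: "a13 + a14 \<le> a1"
proof -
  have "(a13 + a14) * n 1 \<le> a1 * n 1"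
    unfolding weights(1) distrib_right using incr by (intro add_mono mult_le_mono2) auto
  then show ?thesis using pos by simp
qed

lemma a4_le_degree: "a4 \<le> a41 + a42"
proof -
  have "a4 * n 4 \<le> (a41 + a42) * n 4"
    unfolding weights(4) distrib_right using incr by (intro add_mono mult_le_mono2) auto
  then show ?thesis using pos by simp
qed

text \<open>The fibre consists of the monomials \<open>x2 ^ (u2 - k * a32) * x3 ^ (u3 + k * a3) * x4 ^ (u4 - k * a34)\<close>.
For \<open>k = 0\<close> the assumptions exclude every exchange other than that of \<open>x2 ^ a32 * x4 ^ a34\<close> for
\<open>x3 ^ a3\<close>. For \<open>k > 0\<close> the inequalities \<open>a2_le\<close> and \<open>a4_le\<close> make the exponents of \<open>x2\<close> and
\<open>x4\<close> too small for the terms of \<open>f1\<close> and \<open>f5\<close>.\<close>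

lemma stuck_fibre_avoids_x1:
  assumes u: "u2 < a2" "u3 < a3" "u4 < a4"
    and stuck: "\<not> (a42 \<le> u2 \<and> a13 \<le> u3)" "\<not> (a13 \<le> u3 \<and> a14 \<le> u4)"
    and v: "wt n v = wt n (expo 0 u2 u3 u4)"
  shows "ev v 1 = 0"
proof -
  define P where "P a b c d \<longleftrightarrow> a = 0 \<and> (\<exists>k. b + k * a32 = u2 \<and> c = u3 + k * a3 \<and> d + k * a34 = u4)"
    for a b c d :: nat
  have "P (ev v 1) (ev v 2) (ev v 3) (ev v 4)"
  proof (rule fibre_in_closed_predicate[OF _ _ _ _ _ _ v])
    fix a b c d
    have "\<not> P a b (c + a13) (d + a14)"
    proof
      assume "P a b (c + a13) (d + a14)"
      then obtain k where k: "c + a13 = u3 + k * a3" "d + a14 + k * a34 = u4" unfolding P_def by blast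
      then show False using stuck(2) u(3) a4_le by (cases k) auto
    qed
    then show "P (a + a1) b c d \<longleftrightarrow> P a b (c + a13) (d + a14)" using exponents by (auto simp: P_def)
    have "\<not> P a (b + a42) (c + a13) d"
    proof
      assume "P a (b + a42) (c + a13) d"
      then obtain k where k: "b + a42 + k * a32 = u2" "c + a13 = u3 + k * a3" unfolding P_def by blast
      then show False using stuck(1) u(1) a2_le by (cases k) auto
    qed
    then show "P (a + a21) b c (d + a34) \<longleftrightarrow> P a (b + a42) (c + a13) d"
      using exponents by (auto simp: P_def)
    show "P a (b + a2) c d \<longleftrightarrow> P (a + a21) b (c + a23) d"
      using exponents u(1) by (auto simp: P_def)
    show "P a b c (d + a4) \<longleftrightarrow> P (a + a41) (b + a42) c d"
      using exponents u(3) by (auto simp: P_def)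
    show "P a b (c + a3) d \<longleftrightarrow> P a (b + a32) c (d + a34)"
    proof
      assume "P a b (c + a3) d"
      then obtain k where k: "a = 0" "b + k * a32 = u2" "c + a3 = u3 + k * a3" "d + k * a34 = u4"
        unfolding P_def by blast
      then obtain l where "k = Suc l" using u(2) by (cases k) auto
      with k show "P a (b + a32) c (d + a34)" unfolding P_def by (intro conjI exI[of _ l]) auto
    next
      assume "P a (b + a32) c (d + a34)"
      then obtain k where k: "a = 0" "b + a32 + k * a32 = u2" "c = u3 + k * a3" "d + a34 + k * a34 = u4"
        unfolding P_def by blast
      then show "P a b (c + a3) d" unfolding P_def by (intro conjI exI[of _ "Suc k"]) auto
    qed
  next
    show "P (ev (expo 0 u2 u3 u4) 1) (ev (expo 0 u2 u3 u4) 2) (ev (expo 0 u2 u3 u4) 3) (ev (expo 0 u2 u3 u4) 4)"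
      unfolding P_def by (auto intro: exI[of _ 0])
  qed
  then show ?thesis by (simp add: P_def)
qed

text \<open>Necessity comes from the two-element fibres of \<open>x2 ^ a2\<close> and \<open>x2 ^ a42 * x3 ^ a13\<close>. For sufficiency,
a monomial without \<open>x1\<close> either contains a term of a generator that can be exchanged for a multiple of
\<open>x1\<close> of no smaller degree, or is covered by the third condition, or has no multiple of \<open>x1\<close> in its
fibre.\<close>

lemma tangent_cone_criterion:
  "(\<forall>M v. wt n v = wt n M \<and> 0 < ev v 1 \<longrightarrow> (\<exists>N. 0 < ev N 1 \<and> wt n N = wt n M \<and> mdeg M \<le> mdeg N)) \<longleftrightarrow>
    a2 \<le> a21 + a23 \<and> a42 + a13 \<le> a21 + a34 \<and>
    (\<forall>u2 u3 u4 v. u2 < a42 \<and> a3 \<le> u3 \<and> u4 < a14 \<and> wt n v = wt n (expo 0 u2 u3 u4) \<and> 0 < ev v 1 \<longrightarrow>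
       (\<exists>N. 0 < ev N 1 \<and> wt n N = wt n (expo 0 u2 u3 u4) \<and> mdeg (expo 0 u2 u3 u4) \<le> mdeg N))"
    (is "?star \<longleftrightarrow> ?c1 \<and> ?c2 \<and> ?c3")
proof
  assume star: ?star
  have ?c1
  proof -
    have "wt n (expo a21 0 a23 0) = wt n (expo 0 a2 0 0)" using weights by (simp add: wt_ev)
    then obtain N where "0 < ev N 1" "wt n N = wt n (expo 0 a2 0 0)" "mdeg (expo 0 a2 0 0) \<le> mdeg N"
      using star[rule_format, of "expo a21 0 a23 0" "expo 0 a2 0 0"] exponents by auto
    with fibre_x2_power[of N] show ?thesis by (simp add: wt_ev mdeg_ev)
  qed
  moreover have ?c2
  proof -
    have "wt n (expo a21 0 0 a34) = wt n (expo 0 a42 a13 0)" using weights by (simp add: wt_ev)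
    then obtain N where "0 < ev N 1" "wt n N = wt n (expo 0 a42 a13 0)" "mdeg (expo 0 a42 a13 0) \<le> mdeg N"
      using star[rule_format, of "expo a21 0 0 a34" "expo 0 a42 a13 0"] exponents by auto
    with fibre_x2_x3_product[of N] show ?thesis by (simp add: wt_ev mdeg_ev)
  qed
  ultimately show "?c1 \<and> ?c2 \<and> ?c3" using star by blast
next
  assume c: "?c1 \<and> ?c2 \<and> ?c3"
  show ?star
  proof (intro allI impI)
    fix M v assume v: "wt n v = wt n M \<and> 0 < ev v 1"
    define u2 u3 u4 where "u2 = ev M 2" and "u3 = ev M 3" and "u4 = ev M 4"
    let ?goal = "\<exists>N. 0 < ev N 1 \<and> wt n N = wt n M \<and> mdeg M \<le> mdeg N"
    have exchange: ?goal
      if "M = w + q" "wt n p = wt n q" "mdeg q \<le> mdeg p" "0 < ev p 1" for w p q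
      using that by (intro exI[of _ "w + p"]) (simp add: lookup_add)
    show ?goal
    proof (cases "0 < ev M 1")
      case True
      then show ?thesis by auto
    next
      case False
      then have M: "M = expo 0 u2 u3 u4" using expo_ev[of M] by (simp add: u2_def u3_def u4_def)
      consider (x2) "a2 \<le> u2" | (x4) "a4 \<le> u4" | (x23) "a42 \<le> u2" "a13 \<le> u3"
        | (x34) "a13 \<le> u3" "a14 \<le> u4" | (x3) "u2 < a42" "a3 \<le> u3" "u4 < a14"
        | (stuck) "u2 < a2" "u3 < a3" "u4 < a4" "\<not> (a42 \<le> u2 \<and> a13 \<le> u3)" "\<not> (a13 \<le> u3 \<and> a14 \<le> u4)"
        using exponents by linarith
      then show ?thesis
      proof cases
        case x2
        show ?thesis
          by (rule exchange[of "expo 0 (u2 - a2) u3 u4" "expo 0 a2 0 0" "expo a21 0 a23 0"])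
            (use x2 c weights exponents in \<open>auto simp: M expo_add wt_ev mdeg_ev\<close>)
      next
        case x4
        show ?thesis
          by (rule exchange[of "expo 0 u2 u3 (u4 - a4)" "expo 0 0 0 a4" "expo a41 a42 0 0"])
            (use x4 a4_le_degree weights exponents in \<open>auto simp: M expo_add wt_ev mdeg_ev\<close>)
      next
        case x23
        show ?thesis
          by (rule exchange[of "expo 0 (u2 - a42) (u3 - a13) u4" "expo 0 a42 a13 0" "expo a21 0 0 a34"])
            (use x23 c weights exponents in \<open>auto simp: M expo_add wt_ev mdeg_ev\<close>)
      next
        case x34
        show ?thesis
          by (rule exchange[of "expo 0 u2 (u3 - a13) (u4 - a14)" "expo 0 0 a13 a14" "expo a1 0 0 0"])
            (use x34 a1_ge weights exponents in \<open>auto simp: M expo_add wt_ev mdeg_ev\<close>)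
      next
        case x3
        then show ?thesis using c v unfolding M by blast
      next
        case stuck
        then have "ev v 1 = 0" using stuck_fibre_avoids_x1 v unfolding M by blast
        with v show ?thesis by simp
      qed
    qed
  qed
qed

end


theorem proposition3p9:
  fixes n :: "4 \<Rightarrow> nat"
    and I :: "'k::field poly4 set"
    and a1 a2 a3 a4 a13 a14 a21 a23 a32 a34 a41 a42 :: nat
  assumes pos: "\<forall>i. 0 < n i"
    and gcd: "Gcd (range n) = 1"
    and incr: "n 1 < n 2" "n 2 < n 3" "n 3 < n 4"
    and I: "I = curve_ideal n"
    and gorenstein: "symmetric_semigroup (num_semigroup n)"
    and not_ci: "\<not> curve_complete_intersection I"
    and exponents:
      "0 < a21" "a21 < a1" "0 < a41" "a41 < a1"
      "0 < a32" "a32 < a2" "0 < a42" "a42 < a2"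
      "0 < a13" "a13 < a3" "0 < a23" "a23 < a3"
      "0 < a14" "a14 < a4" "0 < a34" "a34 < a4"
    and gens: "minimally_generates
      {Var 1 ^ a1 - Var 3 ^ a13 * Var 4 ^ a14,
       Var 2 ^ a2 - Var 1 ^ a21 * Var 3 ^ a23,
       Var 3 ^ a3 - Var 2 ^ a32 * Var 4 ^ a34,
       Var 4 ^ a4 - Var 1 ^ a41 * Var 2 ^ a42,
       Var 1 ^ a21 * Var 4 ^ a34 - Var 2 ^ a42 * Var 3 ^ a13} I"
  shows "cm_tangent_cone I \<longleftrightarrow>
    a2 \<le> a21 + a23 \<and>
    a42 + a13 \<le> a21 + a34 \<and>
    (\<forall>M u2 u3 u4.
       M = Poly_Mapping.single 2 u2 + Poly_Mapping.single 3 u3 + Poly_Mapping.single 4 u4 \<and>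
       u2 < a42 \<and> a3 \<le> u3 \<and> u4 < a14 \<and>
       u2 * n 2 + u3 * n 3 + u4 * n 4 \<in> {n 1 + m | m. m \<in> num_semigroup n} \<longrightarrow>
       (\<exists>N. 1 \<in> Poly_Mapping.keys N \<and> monom4 M - monom4 N \<in> I \<and> mdeg M \<le> mdeg N))"
proof -
  interpret least_first_weight n
  proof
    fix i :: 4 assume "i \<noteq> 1"
    then show "n 1 < n i" using four_cases[of i] incr by auto
  qed (rule pos)
  interpret five_binomial_curve n a1 a2 a3 a4 a13 a14 a21 a23 a32 a34 a41 a42 "TYPE('k)"
    using pos incr exponents gens unfolding minimally_generates_def I by unfold_locales auto
  have M: "Poly_Mapping.single 2 u2 + Poly_Mapping.single 3 u3 + Poly_Mapping.single 4 u4
      = expo 0 u2 u3 u4" for u2 u3 u4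
    by (simp add: expo_def)
  have wt: "u2 * n 2 + u3 * n 3 + u4 * n 4 = wt n (expo 0 u2 u3 u4)" for u2 u3 u4
    by (simp add: wt_ev)
  have N: "1 \<in> Poly_Mapping.keys N \<and> monom4 M - monom4 N \<in> I \<and> mdeg M \<le> mdeg N
      \<longleftrightarrow> 0 < ev N 1 \<and> wt n N = wt n M \<and> mdeg M \<le> mdeg N" for M N
    unfolding I binomial_in_curve_ideal_iff by (auto simp: in_keys_iff)
  show ?thesis
    unfolding I[THEN arg_cong, of cm_tangent_cone] cm_tangent_cone_iff tangent_cone_criterion
      N M wt x1_shifted_semigroup
    by blast
qed

end
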